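(* Let $D=\{1,\dots,d\}$, let $V_1,\dots,V_d$ be real vector spaces, and let $\mathbf{v}\in\mathbf{V}_D={}_a\bigotimes_{j=1}^d V_j$. Let $\alpha\subset D$ with $\#\alpha\ge 2$ and let $\mathcal{P}_\alpha$ be a non-trivial partition of $\alpha$. Assume that $\mathbf{V}_\alpha$ and $\mathbf{V}_\beta$, for $\beta\in\mathcal{P}_\alpha$, are normed spaces. Then for each $\beta\in\mathcal{P}_\alpha$, $$U_\beta^{\min}(\mathbf{v})=\mathrm{span}\left\{\left(id_\beta\otimes\boldsymbol{\varphi}^{(\alpha\setminus\beta)}\right)(\mathbf{v}_\alpha)\;:\;\mathbf{v}_\alpha\in U_\alpha^{\min}(\mathbf{v}),\ \boldsymbol{\varphi}^{(\alpha\setminus\beta)}\in {}_a\bigotimes_{\gamma\in\mathcal{P}_\alpha\setminus\{\beta\}}\mathbf{V}_\gamma^{*}\right\}.$$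
   Context: All vector spaces are over $\mathbb{R}$. ${}_a\bigotimes$ denotes the algebraic tensor product (finite linear combinations of elementary tensors). For a non-empty $\alpha\subset D$, $\mathbf{V}_\alpha:={}_a\bigotimes_{j\in\alpha}V_j$, with $\mathbf{V}_{\{j\}}=V_j$; for $\emptyset\ne\alpha\subsetneq D$ and $\alpha^c=D\setminus\alpha$, $\mathbf{V}_D$ is identified with $\mathbf{V}_\alpha\otimes_a\mathbf{V}_{\alpha^c}$, and $\mathbf{V}_\alpha$ is identified with ${}_a\bigotimes_{\beta\in\mathcal{P}_\alpha}\mathbf{V}_\beta$ for a partition $\mathcal{P}_\alpha$ of $\alpha$. A partition of $\alpha$ is non-trivial if it has at least two (non-empty, pairwise disjoint) blocks. Minimal subspace: for $\mathbf{v}\in\mathbf{V}_D$ and $\emptyset\neq\alpha\subsetneq D$, $U_\alpha^{\min}(\mathbf{v})\subset\mathbf{V}_\alpha$ is the unique subspace such that $\mathbf{v}\in U_\alpha^{\min}(\mathbf{v})\otimes_a\mathbf{V}_{\alpha^c}$, and such that $\mathbf{v}\in\mathbf{U}_\alpha\otimes_a\mathbf{V}_{\alpha^c}$ for a subspace $\mathbf{U}_\alpha\subset\mathbf{V}_\alpha$ implies $U_\alpha^{\min}(\mathbf{v})\subset\mathbf{U}_\alpha$. It exists and is finite-dimensional. By convention $U_D^{\min}(\mathbf{v})=\mathrm{span}\{\mathbf{v}\}$. For a normed space $V$, $V^*$ is its topological dual. An element $\boldsymbol{\varphi}\in{}_a\bigotimes_{\gamma\in\mathcal{P}_\alpha\setminus\{\beta\}}\mathbf{V}_\gamma^*$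 is viewed as a linear functional on ${}_a\bigotimes_{\gamma\in\mathcal{P}_\alpha\setminus\{\beta\}}\mathbf{V}_\gamma$ via $(\bigotimes_\gamma\varphi_\gamma)(\bigotimes_\gamma w_\gamma)=\prod_\gamma\varphi_\gamma(w_\gamma)$, extended linearly, and $id_\beta\otimes\boldsymbol{\varphi}:\mathbf{V}_\alpha\to\mathbf{V}_\beta$ is the linear map determined by $w_\beta\otimes\mathbf{w}\mapsto\boldsymbol{\varphi}(\mathbf{w})\,w_\beta$. *)

theory Defs
  imports
    "HOL-Analysis.Analysis"
    "HOL-Analysis.Finite_Function_Topology"
    "HOL-Library.Function_Algebras"
    "HOL-Library.Disjoint_Sets"
begin

instantiation "fun" :: (type, real_vector) real_vector
begin

definition scaleR_fun :: "real \<Rightarrow> ('a \<Rightarrow> 'b) \<Rightarrow> 'a \<Rightarrow> 'b"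
  where "scaleR_fun c f = (\<lambda>x. c *\<^sub>R f x)"

instance
  by standard (auto simp: scaleR_fun_def plus_fun_def scaleR_add_right scaleR_add_left)

end

lemma scaleR_fun_apply: "(c *\<^sub>R f) x = c *\<^sub>R f x"
  by (simp add: scaleR_fun_def)

section \<open>Algebraic tensor products\<close>

text \<open>
  The type \<open>('i, 'a) tensor\<close> is the quotient of the free real vector space on the partial maps
  \<open>'i \<rightharpoonup> 'a\<close> by the multilinearity relations.  A partial map with domain \<open>I\<close> stands for a
  family \<open>(x\<^sub>i)\<close> with \<open>i \<in> I\<close>, so the type is the direct sum, over all index sets \<open>I\<close>, of the
  tensor products of \<open>I\<close>-indexed families of copies of \<open>'a\<close>.  For subspaces \<open>V i\<close> of \<open>'a\<close>,
  the tensor product of the \<open>V i\<close> is the span of the elementary tensors with factors in \<open>V i\<close>;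
  \<open>tensor_product_universal\<close> below is its universal property.
\<close>

definition tensor_relations :: "(('i \<Rightarrow> 'a::real_vector option), real) poly_mapping set" where
  "tensor_relations =
     {Poly_Mapping.single (m(i \<mapsto> a + b)) 1 - Poly_Mapping.single (m(i \<mapsto> a)) 1
        - Poly_Mapping.single (m(i \<mapsto> b)) 1 | m i a b. True} \<union>
     {Poly_Mapping.single (m(i \<mapsto> c *\<^sub>R a)) 1
        - c *\<^sub>R Poly_Mapping.single (m(i \<mapsto> a)) 1 | m i c a. True}"

definition tensor_eq ::
  "(('i \<Rightarrow> 'a::real_vector option), real) poly_mapping \<Rightarrow>
   (('i \<Rightarrow> 'a option), real) poly_mapping \<Rightarrow> bool" where
  "tensor_eq f g \<longleftrightarrow> f - g \<in> span tensor_relations"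

lemma equivp_tensor_eq: "equivp tensor_eq"
proof (rule equivpI)
  show "reflp tensor_eq" by (auto simp: reflp_def tensor_eq_def span_zero)
  show "symp tensor_eq"
    unfolding symp_def tensor_eq_def using span_neg by fastforce
  show "transp tensor_eq"
    unfolding transp_def tensor_eq_def using span_add by fastforce
qed

quotient_type (overloaded) ('i, 'a) tensor =
  "(('i \<Rightarrow> 'a::real_vector option), real) poly_mapping" / tensor_eq
  by (rule equivp_tensor_eq)

instantiation tensor :: (type, real_vector) real_vector
begin

lift_definition zero_tensor :: "('a, 'b) tensor" is 0 .

lift_definition plus_tensor :: "('a, 'b) tensor \<Rightarrow> ('a, 'b) tensor \<Rightarrow> ('a, 'b) tensor" is "(+)"
  unfolding tensor_eq_def add_diff_add by (rule span_add)

lift_definition uminus_tensor :: "('a, 'b) tensor \<Rightarrow> ('a, 'b) tensor" is uminus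
  unfolding tensor_eq_def minus_diff_minus by (rule span_neg)

lift_definition minus_tensor :: "('a, 'b) tensor \<Rightarrow> ('a, 'b) tensor \<Rightarrow> ('a, 'b) tensor" is "(-)"
  unfolding tensor_eq_def
proof -
  fix f f' g g' :: "(('a \<Rightarrow> 'b option), real) poly_mapping"
  assume "f - f' \<in> span tensor_relations" "g - g' \<in> span tensor_relations"
  then have "(f - f') - (g - g') \<in> span tensor_relations" by (rule span_diff)
  then show "f - g - (f' - g') \<in> span tensor_relations" by (simp add: algebra_simps)
qed

lift_definition scaleR_tensor :: "real \<Rightarrow> ('a, 'b) tensor \<Rightarrow> ('a, 'b) tensor" is scaleR
  unfolding tensor_eq_def scaleR_right_diff_distrib[symmetric] by (rule span_scale)

instance
  by standard
    (transfer; simp add: tensor_eq_def span_zero algebra_simps)+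

end

lift_definition elem_tensor :: "'i set \<Rightarrow> ('i \<Rightarrow> 'a::real_vector) \<Rightarrow> ('i, 'a) tensor"
  is "\<lambda>I x. Poly_Mapping.single (\<lambda>i. if i \<in> I then Some (x i) else None) 1" .

definition tensor_product ::
  "'i set \<Rightarrow> ('i \<Rightarrow> 'a::real_vector set) \<Rightarrow> ('i, 'a) tensor set" where
  "tensor_product I V = span {elem_tensor I x | x. \<forall>i\<in>I. x i \<in> V i}"

definition multilinear_on ::
  "'i set \<Rightarrow> ('i \<Rightarrow> 'a::real_vector set) \<Rightarrow> (('i \<Rightarrow> 'a) \<Rightarrow> 'b::real_vector) \<Rightarrow> bool" where
  "multilinear_on I V M \<longleftrightarrow>
     (\<forall>x y. (\<forall>i\<in>I. x i = y i) \<longrightarrow> M x = M y) \<and>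
     (\<forall>x. (\<forall>i\<in>I. x i \<in> V i) \<longrightarrow>
        (\<forall>i\<in>I. \<forall>a\<in>V i. \<forall>b\<in>V i. M (x(i := a + b)) = M (x(i := a)) + M (x(i := b))) \<and>
        (\<forall>i\<in>I. \<forall>c. \<forall>a\<in>V i. M (x(i := c *\<^sub>R a)) = c *\<^sub>R M (x(i := a))))"

lemma multilinear_onI:
  assumes "\<And>x y. (\<And>i. i \<in> I \<Longrightarrow> x i = y i) \<Longrightarrow> M x = M y"
    and "\<And>x i a b. (\<And>j. j \<in> I \<Longrightarrow> x j \<in> V j) \<Longrightarrow> i \<in> I \<Longrightarrow> a \<in> V i \<Longrightarrow> b \<in> V i \<Longrightarrow>
           M (x(i := a + b)) = M (x(i := a)) + M (x(i := b))"
    and "\<And>x i c a. (\<And>j. j \<in> I \<Longrightarrow> x j \<in> V j) \<Longrightarrow> i \<in> I \<Longrightarrow> a \<in> V i \<Longrightarrow>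
           M (x(i := c *\<^sub>R a)) = c *\<^sub>R M (x(i := a))"
  shows "multilinear_on I V M"
  unfolding multilinear_on_def using assms by blast

lemma multilinear_on_cong: "multilinear_on I V M \<Longrightarrow> (\<And>i. i \<in> I \<Longrightarrow> x i = y i) \<Longrightarrow> M x = M y"
  unfolding multilinear_on_def by blast

lemma multilinear_on_add:
  "multilinear_on I V M \<Longrightarrow> (\<And>j. j \<in> I \<Longrightarrow> x j \<in> V j) \<Longrightarrow> i \<in> I \<Longrightarrow> a \<in> V i \<Longrightarrow> b \<in> V i \<Longrightarrow>
   M (x(i := a + b)) = M (x(i := a)) + M (x(i := b))"
  unfolding multilinear_on_def by simp

lemma multilinear_on_scaleR:
  "multilinear_on I V M \<Longrightarrow> (\<And>j. j \<in> I \<Longrightarrow> x j \<in> V j) \<Longrightarrow> i \<in> I \<Longrightarrow> a \<in> V i \<Longrightarrow>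
   M (x(i := c *\<^sub>R a)) = c *\<^sub>R M (x(i := a))"
  unfolding multilinear_on_def by simp

lemma elem_tensor_cong: "(\<And>i. i \<in> I \<Longrightarrow> x i = y i) \<Longrightarrow> elem_tensor I x = elem_tensor I y"
proof -
  assume "\<And>i. i \<in> I \<Longrightarrow> x i = y i"
  then have "(\<lambda>i. if i \<in> I then Some (x i) else None) = (\<lambda>i. if i \<in> I then Some (y i) else None)"
    by auto
  then show "elem_tensor I x = elem_tensor I y"
    by (simp add: elem_tensor.abs_eq)
qed

lemma elem_tensor_upd:
  assumes "i \<in> I"
  shows "(\<lambda>j. if j \<in> I then Some ((x(i := c)) j) else None) =
      (\<lambda>j. if j \<in> I then Some (x j) else None)(i \<mapsto> c)"
  using assms by auto

lemma elem_tensor_add: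
  assumes "i \<in> I"
  shows "elem_tensor I (x(i := a + b)) = elem_tensor I (x(i := a)) + elem_tensor I (x(i := b))"
  unfolding elem_tensor.abs_eq plus_tensor.abs_eq tensor.abs_eq_iff tensor_eq_def
    elem_tensor_upd[OF assms] diff_diff_eq[symmetric]
  by (rule span_base) (unfold tensor_relations_def, blast)

lemma elem_tensor_scaleR:
  assumes "i \<in> I"
  shows "elem_tensor I (x(i := c *\<^sub>R a)) = c *\<^sub>R elem_tensor I (x(i := a))"
  unfolding elem_tensor.abs_eq scaleR_tensor.abs_eq tensor.abs_eq_iff tensor_eq_def
    elem_tensor_upd[OF assms]
  by (rule span_base) (unfold tensor_relations_def, blast)

lemma multilinear_on_elem_tensor: "multilinear_on I V (elem_tensor I)"
  by (rule multilinear_onI) (auto intro: elem_tensor_cong elem_tensor_add elem_tensor_scaleR)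

lemma tensor_universal_UNIV:
  fixes M :: "('i \<Rightarrow> 'a::real_vector) \<Rightarrow> 'b::real_vector"
  assumes M: "multilinear_on I (\<lambda>_. UNIV) M"
  shows "\<exists>L. linear L \<and> (\<forall>x. L (elem_tensor I x) = M x)"
proof -
  define g where "g m = (if dom m = I then M (\<lambda>i. the (m i)) else 0)" for m :: "'i \<Rightarrow> 'a option"
  define F where "F f = (\<Sum>k\<in>Poly_Mapping.keys f. Poly_Mapping.lookup f k *\<^sub>R g k)"
    for f :: "('i \<Rightarrow> 'a option, real) poly_mapping"
  have F: "F f = (\<Sum>k\<in>A. Poly_Mapping.lookup f k *\<^sub>R g k)"
    if "finite A" "Poly_Mapping.keys f \<subseteq> A" for f A
    unfolding F_def using that by (intro sum.mono_neutral_left) (auto simp: in_keys_iff)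
  have linF: "linear F"
  proof (rule linearI)
    fix f h :: "('i \<Rightarrow> 'a option, real) poly_mapping"
    let ?A = "Poly_Mapping.keys f \<union> Poly_Mapping.keys h"
    have "F (f + h) = (\<Sum>k\<in>?A. Poly_Mapping.lookup (f + h) k *\<^sub>R g k)"
      by (rule F) (auto simp: Poly_Mapping.keys_add)
    also have "\<dots> = F f + F h"
      by (subst (1 2) F[of ?A]) (auto simp: lookup_add scaleR_add_left sum.distrib)
    finally show "F (f + h) = F f + F h" .
  next
    fix c :: real and f :: "('i \<Rightarrow> 'a option, real) poly_mapping"
    have lk: "Poly_Mapping.lookup (c *\<^sub>R f) k = c * Poly_Mapping.lookup f k" for k
    proof -
      have "finite {i. c *\<^sub>R Poly_Mapping.lookup f i \<noteq> 0}"
        by (rule finite_subset[OF _ finite_lookup[of f]]) auto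
      then show ?thesis by (simp add: scaleR_poly_mapping_def)
    qed
    have "F (c *\<^sub>R f) = (\<Sum>k\<in>Poly_Mapping.keys f. Poly_Mapping.lookup (c *\<^sub>R f) k *\<^sub>R g k)"
      by (rule F) (auto simp: in_keys_iff lk)
    also have "\<dots> = c *\<^sub>R F f"
      by (simp add: F_def scaleR_sum_right lk)
    finally show "F (c *\<^sub>R f) = c *\<^sub>R F f" .
  qed
  have Fs: "F (Poly_Mapping.single k 1) = g k" for k
    by (simp add: F_def)
  have upd: "(\<lambda>j. the ((m(i \<mapsto> a)) j)) = (\<lambda>j. the (m j))(i := a)" for m :: "'i \<Rightarrow> 'a option" and i a
    by auto
  have "F r = 0" if "r \<in> tensor_relations" for r
    using that unfolding tensor_relations_def
  proof (elim UnE CollectE exE conjE)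
    fix m i a b
    assume r: "r = Poly_Mapping.single (m(i \<mapsto> a + b)) 1 - Poly_Mapping.single (m(i \<mapsto> a)) 1
        - Poly_Mapping.single (m(i \<mapsto> b)) 1"
    have "g (m(i \<mapsto> a + b)) = g (m(i \<mapsto> a)) + g (m(i \<mapsto> b))"
      unfolding g_def upd using M by (auto simp: multilinear_on_def)
    then show "F r = 0"
      by (simp add: r linear_diff[OF linF] Fs)
  next
    fix m i c a
    assume r: "r = Poly_Mapping.single (m(i \<mapsto> c *\<^sub>R a)) 1
        - c *\<^sub>R Poly_Mapping.single (m(i \<mapsto> a)) 1"
    have "g (m(i \<mapsto> c *\<^sub>R a)) = c *\<^sub>R g (m(i \<mapsto> a))"
      unfolding g_def upd using M by (auto simp: multilinear_on_def)
    then show "F r = 0"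
      by (simp add: r linear_diff[OF linF] linear_cmul[OF linF] Fs)
  qed
  then have ker: "F r = 0" if "r \<in> span tensor_relations" for r
    using that linear_eq_0_on_span[OF linF] by blast
  define L where "L t = F (rep_tensor t)" for t
  have L: "L (abs_tensor f) = F f" for f
  proof -
    have "tensor_eq (rep_tensor (abs_tensor f)) f"
      using Quotient3_tensor Quotient3_rep_abs equivp_tensor_eq equivp_reflp by metis
    then have "F (rep_tensor (abs_tensor f) - f) = 0"
      unfolding tensor_eq_def by (rule ker)
    then show ?thesis by (simp add: L_def linear_diff[OF linF])
  qed
  have "linear L"
  proof (rule linearI)
    fix s t :: "('i, 'a) tensor" and c :: real
    obtain f h where fh: "s = abs_tensor f" "t = abs_tensor h"
      using Quotient3_abs_rep[OF Quotient3_tensor] by metis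
    show "L (s + t) = L s + L t"
      by (simp add: fh plus_tensor.abs_eq L linear_add[OF linF])
    show "L (c *\<^sub>R s) = c *\<^sub>R L s"
      by (simp add: fh scaleR_tensor.abs_eq L linear_cmul[OF linF])
  qed
  moreover have "L (elem_tensor I x) = M x" for x
  proof -
    have "dom (\<lambda>i. if i \<in> I then Some (x i) else None) = I"
      by (auto simp: dom_def)
    then have "L (elem_tensor I x) = M (\<lambda>i. the (if i \<in> I then Some (x i) else None))"
      by (simp add: elem_tensor.abs_eq L Fs g_def)
    also have "\<dots> = M x"
      by (rule multilinear_on_cong[OF M]) simp
    finally show ?thesis .
  qed
  ultimately show ?thesis by blast
qed

theorem tensor_product_universal:
  fixes M :: "('i \<Rightarrow> 'a::real_vector) \<Rightarrow> 'b::real_vector"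
  assumes V: "\<And>i. i \<in> I \<Longrightarrow> subspace (V i)" and M: "multilinear_on I V M"
  shows "\<exists>L. linear L \<and> (\<forall>x. (\<forall>i\<in>I. x i \<in> V i) \<longrightarrow> L (elem_tensor I x) = M x)"
proof -
  have "\<exists>g::'a \<Rightarrow> 'a. range g \<subseteq> V i \<and> linear g \<and> (\<forall>v\<in>V i. g v = v)" if "i \<in> I" for i
    using linear_exists_left_inverse_on[OF linear_id V[OF that]] by simp
  then obtain p :: "'i \<Rightarrow> 'a \<Rightarrow> 'a"
    where p: "\<And>i. i \<in> I \<Longrightarrow> range (p i) \<subseteq> V i" "\<And>i. i \<in> I \<Longrightarrow> linear (p i)"
      "\<And>i v. i \<in> I \<Longrightarrow> v \<in> V i \<Longrightarrow> p i v = v"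
    by metis
  have upd: "(\<lambda>j. p j ((x(i := a)) j)) = (\<lambda>j. p j (x j))(i := p i a)" for x i a
    by auto
  have pV: "p i a \<in> V i" if "i \<in> I" for i a
    using p(1)[OF that] by auto
  have cong: "M x = M y" if "\<And>i. i \<in> I \<Longrightarrow> x i = y i" for x y
    using M that by (rule multilinear_on_cong)
  have "multilinear_on I (\<lambda>_. UNIV) (\<lambda>x. M (\<lambda>i. p i (x i)))"
  proof (rule multilinear_onI)
    fix x y :: "'i \<Rightarrow> 'a" assume "\<And>i. i \<in> I \<Longrightarrow> x i = y i"
    then show "M (\<lambda>i. p i (x i)) = M (\<lambda>i. p i (y i))" by (intro cong) auto
  next
    fix x i a b assume i: "i \<in> I"
    show "M (\<lambda>j. p j ((x(i := a + b)) j)) =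
        M (\<lambda>j. p j ((x(i := a)) j)) + M (\<lambda>j. p j ((x(i := b)) j))"
      unfolding upd linear_add[OF p(2)[OF i]]
      by (rule multilinear_on_add[OF M]) (use i pV in auto)
  next
    fix x i c a assume i: "i \<in> I"
    show "M (\<lambda>j. p j ((x(i := c *\<^sub>R a)) j)) = c *\<^sub>R M (\<lambda>j. p j ((x(i := a)) j))"
      unfolding upd linear_cmul[OF p(2)[OF i]]
      by (rule multilinear_on_scaleR[OF M]) (use i pV in auto)
  qed
  from tensor_universal_UNIV[OF this] obtain L
    where L: "linear L" "\<And>x. L (elem_tensor I x) = M (\<lambda>i. p i (x i))"
    by blast
  have "L (elem_tensor I x) = M x" if "\<forall>i\<in>I. x i \<in> V i" for x
    unfolding L(2) by (rule cong) (use that p(3) in auto)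
  with L(1) show ?thesis by blast
qed

text \<open>
  \<open>tensor_lift I V M\<close> is the linear map on \<open>tensor_product I V\<close> determined by the multilinear
  map \<open>M\<close>, continued by \<open>0\<close> outside of that subspace.  The linear map \<open>L\<close> lives on the whole
  type, but its values on \<open>tensor_product I V\<close> do not depend on the choice.
\<close>

definition tensor_lift ::
  "'i set \<Rightarrow> ('i \<Rightarrow> 'a::real_vector set) \<Rightarrow> (('i \<Rightarrow> 'a) \<Rightarrow> 'b::real_vector) \<Rightarrow>
   ('i, 'a) tensor \<Rightarrow> 'b" where
  "tensor_lift I V M t =
     (if t \<in> tensor_product I V
      then (SOME L. linear L \<and> (\<forall>x. (\<forall>i\<in>I. x i \<in> V i) \<longrightarrow> L (elem_tensor I x) = M x)) t
      else 0)"

lemma tensor_lift_eqI: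
  assumes L: "linear L" "\<And>x. (\<And>i. i \<in> I \<Longrightarrow> x i \<in> V i) \<Longrightarrow> L (elem_tensor I x) = M x"
    and t: "t \<in> tensor_product I V"
  shows "tensor_lift I V M t = L t"
proof -
  let ?P = "\<lambda>L. linear L \<and> (\<forall>x. (\<forall>i\<in>I. x i \<in> V i) \<longrightarrow> L (elem_tensor I x) = M x)"
  have S: "?P (SOME L. ?P L)"
    by (rule someI[of ?P L]) (use L in blast)
  have "(SOME L. ?P L) t = L t"
    by (rule linear_eq_on_span[OF conjunct1[OF S] L(1) _ t[unfolded tensor_product_def]])
       (use S L(2) in auto)
  then show ?thesis using t by (simp add: tensor_lift_def)
qed

lemma tensor_lift:
  assumes "\<And>i. i \<in> I \<Longrightarrow> subspace (V i)" and "multilinear_on I V M"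
  shows tensor_lift_elem: "(\<And>i. i \<in> I \<Longrightarrow> x i \<in> V i) \<Longrightarrow> tensor_lift I V M (elem_tensor I x) = M x"
    and tensor_lift_add: "s \<in> tensor_product I V \<Longrightarrow> t \<in> tensor_product I V \<Longrightarrow>
      tensor_lift I V M (s + t) = tensor_lift I V M s + tensor_lift I V M t"
    and tensor_lift_scaleR: "s \<in> tensor_product I V \<Longrightarrow>
      tensor_lift I V M (c *\<^sub>R s) = c *\<^sub>R tensor_lift I V M s"
proof -
  obtain L where L: "linear L" "\<And>x. (\<And>i. i \<in> I \<Longrightarrow> x i \<in> V i) \<Longrightarrow> L (elem_tensor I x) = M x"
    using tensor_product_universal[OF assms] by blast
  note eq = tensor_lift_eqI[OF L]
  show "tensor_lift I V M (elem_tensor I x) = M x" if "\<And>i. i \<in> I \<Longrightarrow> x i \<in> V i"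
  proof -
    have "elem_tensor I x \<in> tensor_product I V"
      unfolding tensor_product_def using that by (intro span_base) auto
    then show ?thesis by (simp add: eq L(2) that)
  qed
  show "tensor_lift I V M (s + t) = tensor_lift I V M s + tensor_lift I V M t"
    if "s \<in> tensor_product I V" "t \<in> tensor_product I V"
  proof -
    have "s + t \<in> tensor_product I V"
      using that unfolding tensor_product_def by (rule span_add)
    with that show ?thesis by (simp add: eq linear_add[OF L(1)])
  qed
  show "tensor_lift I V M (c *\<^sub>R s) = c *\<^sub>R tensor_lift I V M s" if "s \<in> tensor_product I V"
  proof -
    have "c *\<^sub>R s \<in> tensor_product I V"
      using that unfolding tensor_product_def by (rule span_scale)
    with that show ?thesis by (simp add: eq linear_cmul[OF L(1)])
  qed
qed

lemma tensor_lift_fun_add: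
  assumes V: "\<And>i. i \<in> I \<Longrightarrow> subspace (V i)"
    and M: "multilinear_on I V M" and M': "multilinear_on I V M'"
  shows "tensor_lift I V (\<lambda>x. M x + M' x) t = tensor_lift I V M t + tensor_lift I V M' t"
proof (cases "t \<in> tensor_product I V")
  case True
  obtain K where K: "linear K" "\<And>x. (\<And>i. i \<in> I \<Longrightarrow> x i \<in> V i) \<Longrightarrow> K (elem_tensor I x) = M x"
    using tensor_product_universal[OF V M] by blast
  obtain L where L: "linear L" "\<And>x. (\<And>i. i \<in> I \<Longrightarrow> x i \<in> V i) \<Longrightarrow> L (elem_tensor I x) = M' x"
    using tensor_product_universal[OF V M'] by blast
  have "tensor_lift I V (\<lambda>x. M x + M' x) t = K t + L t"
    by (rule tensor_lift_eqI[OF linear_compose_add[OF K(1) L(1)] _ True]) (simp add: K(2) L(2))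
  then show ?thesis
    by (simp add: tensor_lift_eqI[OF K True] tensor_lift_eqI[OF L True])
qed (simp add: tensor_lift_def)

lemma tensor_lift_fun_scaleR:
  assumes V: "\<And>i. i \<in> I \<Longrightarrow> subspace (V i)" and M: "multilinear_on I V M"
  shows "tensor_lift I V (\<lambda>x. c *\<^sub>R M x) t = c *\<^sub>R tensor_lift I V M t"
proof (cases "t \<in> tensor_product I V")
  case True
  obtain K where K: "linear K" "\<And>x. (\<And>i. i \<in> I \<Longrightarrow> x i \<in> V i) \<Longrightarrow> K (elem_tensor I x) = M x"
    using tensor_product_universal[OF V M] by blast
  have "tensor_lift I V (\<lambda>x. c *\<^sub>R M x) t = c *\<^sub>R K t"
    by (rule tensor_lift_eqI[OF linear_compose_scale_right[OF K(1)] _ True]) (simp add: K(2))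
  then show ?thesis
    by (simp add: tensor_lift_eqI[OF K True])
qed (simp add: tensor_lift_def)

text \<open>
  For a partition \<open>P\<close>, \<open>regroup P\<close> is the identification of the tensor product over \<open>\<Union>P\<close> with
  the tensor product over \<open>\<beta> \<in> P\<close> of the tensor products over \<open>\<beta>\<close>.
\<close>

definition regroup :: "'i set set \<Rightarrow> ('i, 'a::real_vector) tensor \<Rightarrow> ('i set, ('i, 'a) tensor) tensor"
  where "regroup P = tensor_lift (\<Union>P) (\<lambda>_. UNIV) (\<lambda>x. elem_tensor P (\<lambda>\<beta>. elem_tensor \<beta> x))"

lemma multilinear_on_regroup:
  fixes V :: "'i \<Rightarrow> 'a::real_vector set"
  assumes "disjoint P"
  shows "multilinear_on (\<Union>P) V (\<lambda>x. elem_tensor P (\<lambda>\<beta>. elem_tensor \<beta> x))"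
proof -
  have upd: "\<exists>\<gamma>\<in>P. i \<in> \<gamma> \<and> (\<forall>a. elem_tensor P (\<lambda>\<beta>. elem_tensor \<beta> (x(i := a))) =
      elem_tensor P ((\<lambda>\<beta>. elem_tensor \<beta> x)(\<gamma> := elem_tensor \<gamma> (x(i := a)))))"
    if "i \<in> \<Union>P" for i and x :: "'i \<Rightarrow> 'a"
  proof -
    from that obtain \<gamma> where \<gamma>: "\<gamma> \<in> P" "i \<in> \<gamma>" by blast
    have "elem_tensor \<beta> (x(i := a)) = elem_tensor \<beta> x" if "\<beta> \<in> P" "\<beta> \<noteq> \<gamma>" for \<beta> a
    proof -
      have "i \<notin> \<beta>" using assms \<gamma> that by (auto simp: disjoint_def)
      then show ?thesis by (intro elem_tensor_cong) auto
    qed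
    then have "elem_tensor P (\<lambda>\<beta>. elem_tensor \<beta> (x(i := a))) =
      elem_tensor P ((\<lambda>\<beta>. elem_tensor \<beta> x)(\<gamma> := elem_tensor \<gamma> (x(i := a))))" for a
      by (intro elem_tensor_cong) auto
    with \<gamma> show ?thesis by blast
  qed
  show ?thesis
  proof (rule multilinear_onI)
    fix x y :: "'i \<Rightarrow> 'a" assume "\<And>i. i \<in> \<Union>P \<Longrightarrow> x i = y i"
    then show "elem_tensor P (\<lambda>\<beta>. elem_tensor \<beta> x) = elem_tensor P (\<lambda>\<beta>. elem_tensor \<beta> y)"
      by (intro elem_tensor_cong) blast
  next
    fix x :: "'i \<Rightarrow> 'a" and i and a b :: 'a assume "i \<in> \<Union>P"
    with upd[of i x] show "elem_tensor P (\<lambda>\<beta>. elem_tensor \<beta> (x(i := a + b))) =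
        elem_tensor P (\<lambda>\<beta>. elem_tensor \<beta> (x(i := a))) + elem_tensor P (\<lambda>\<beta>. elem_tensor \<beta> (x(i := b)))"
      by (auto simp: elem_tensor_add)
  next
    fix x :: "'i \<Rightarrow> 'a" and i and a :: 'a and c :: real assume "i \<in> \<Union>P"
    with upd[of i x] show "elem_tensor P (\<lambda>\<beta>. elem_tensor \<beta> (x(i := c *\<^sub>R a))) =
        c *\<^sub>R elem_tensor P (\<lambda>\<beta>. elem_tensor \<beta> (x(i := a)))"
      by (auto simp: elem_tensor_scaleR)
  qed
qed

lemma regroup_elem_tensor:
  "disjoint P \<Longrightarrow> regroup P (elem_tensor (\<Union>P) x) = elem_tensor P (\<lambda>\<beta>. elem_tensor \<beta> x)"
  unfolding regroup_def by (rule tensor_lift_elem) (auto simp: multilinear_on_regroup)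

section \<open>Minimal subspaces\<close>

text \<open>
  For \<open>\<alpha> \<noteq> D\<close>, \<open>supports U\<close> says that \<open>v\<close> lies in the tensor product of \<open>U\<close> with the tensor
  product over the complement of \<open>\<alpha>\<close>, under the identification \<open>regroup {\<alpha>, D - \<alpha>}\<close>.
\<close>

definition min_subspace ::
  "'i set \<Rightarrow> ('i \<Rightarrow> 'a::real_vector set) \<Rightarrow> ('i, 'a) tensor \<Rightarrow> 'i set \<Rightarrow> ('i, 'a) tensor set" where
  "min_subspace D V v \<alpha> =
     (if \<alpha> = D then span {v}
      else
        let supports = (\<lambda>U. subspace U \<and> U \<subseteq> tensor_product \<alpha> V \<and>
          regroup {\<alpha>, D - \<alpha>} v \<in>
            tensor_product {\<alpha>, D - \<alpha>} ((\<lambda>\<gamma>. tensor_product \<gamma> V)(\<alpha> := U)))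
        in THE U. supports U \<and> (\<forall>W. supports W \<longrightarrow> U \<subseteq> W))"

section \<open>Norms on subspaces and topological duals\<close>

definition norm_on :: "'a::real_vector set \<Rightarrow> ('a \<Rightarrow> real) \<Rightarrow> bool" where
  "norm_on S n \<longleftrightarrow>
     (\<forall>x\<in>S. 0 \<le> n x \<and> (n x = 0 \<longleftrightarrow> x = 0)) \<and>
     (\<forall>x\<in>S. \<forall>y\<in>S. n (x + y) \<le> n x + n y) \<and>
     (\<forall>c. \<forall>x\<in>S. n (c *\<^sub>R x) = \<bar>c\<bar> * n x)"

lemma Metric_space_norm_on:
  assumes "subspace S" "norm_on S n"
  shows "Metric_space S (\<lambda>x y. if x \<in> S \<and> y \<in> S then n (x - y) else 0)"
proof
  fix x y z
  have scale: "n ((-1) *\<^sub>R u) = n u" if "u \<in> S" for u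
    using assms(2) that unfolding norm_on_def by (metis abs_minus_cancel abs_one mult_1)
  show "0 \<le> (if x \<in> S \<and> y \<in> S then n (x - y) else 0)"
    using assms by (auto simp: norm_on_def subspace_diff)
  show "(if x \<in> S \<and> y \<in> S then n (x - y) else 0) = (if y \<in> S \<and> x \<in> S then n (y - x) else 0)"
    using scale[of "x - y"] assms(1) by (auto simp: subspace_diff)
  show "((if x \<in> S \<and> y \<in> S then n (x - y) else 0) = 0) = (x = y)" if "x \<in> S" "y \<in> S"
    using that assms by (auto simp: norm_on_def subspace_diff)
  show "(if x \<in> S \<and> z \<in> S then n (x - z) else 0) \<le>
      (if x \<in> S \<and> y \<in> S then n (x - y) else 0) + (if y \<in> S \<and> z \<in> S then n (y - z) else 0)"
    if xyz: "x \<in> S" "y \<in> S" "z \<in> S"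
  proof -
    have "x - y \<in> S" "y - z \<in> S" using xyz assms(1) by (auto intro: subspace_diff)
    then have "n ((x - y) + (y - z)) \<le> n (x - y) + n (y - z)"
      using assms(2) unfolding norm_on_def by blast
    then show ?thesis using xyz by simp
  qed
qed

definition norm_topology :: "'a::real_vector set \<Rightarrow> ('a \<Rightarrow> real) \<Rightarrow> 'a topology" where
  "norm_topology S n =
     Metric_space.mtopology S (\<lambda>x y. if x \<in> S \<and> y \<in> S then n (x - y) else 0)"

text \<open>
  A functional on a subspace \<open>S\<close> is represented by its continuation by \<open>0\<close> outside \<open>S\<close>, so that
  distinct elements of \<open>topological_dual S n\<close> are distinct as functionals on \<open>S\<close>.
\<close>

definition topological_dual :: "'a::real_vector set \<Rightarrow> ('a \<Rightarrow> real) \<Rightarrow> ('a \<Rightarrow> real) set" where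
  "topological_dual S n =
     {\<phi>. (\<forall>x\<in>S. \<forall>y\<in>S. \<phi> (x + y) = \<phi> x + \<phi> y) \<and>
         (\<forall>c. \<forall>x\<in>S. \<phi> (c *\<^sub>R x) = c * \<phi> x) \<and>
         continuous_map (norm_topology S n) euclideanreal \<phi> \<and>
         (\<forall>x. x \<notin> S \<longrightarrow> \<phi> x = 0)}"

lemma subspace_topological_dual: "subspace (topological_dual S n)"
  unfolding subspace_def topological_dual_def
  by (auto simp: plus_fun_def zero_fun_def scaleR_fun_def algebra_simps
      intro!: continuous_map_add continuous_map_real_mult_left)

section \<open>Functionals on tensor products\<close>

text \<open>
  The functional on \<open>tensor_product J W\<close> given by an element of the tensor product of the
  topological duals of the normed spaces \<open>(W j, N j)\<close>.
\<close>

definition tensor_functional ::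
  "'i set \<Rightarrow> ('i \<Rightarrow> 'a::real_vector set) \<Rightarrow> ('i \<Rightarrow> 'a \<Rightarrow> real) \<Rightarrow>
   ('i, 'a \<Rightarrow> real) tensor \<Rightarrow> ('i, 'a) tensor \<Rightarrow> real" where
  "tensor_functional J W N =
     tensor_lift J (\<lambda>j. topological_dual (W j) (N j))
       (\<lambda>\<phi>. tensor_lift J W (\<lambda>w. \<Prod>j\<in>J. \<phi> j (w j)))"

lemma multilinear_on_prod_functionals:
  fixes \<phi> :: "'a \<Rightarrow> 'b::real_vector \<Rightarrow> real"
  assumes "finite J" "\<And>j. j \<in> J \<Longrightarrow> \<phi> j \<in> topological_dual (W j) (N j)"
  shows "multilinear_on J W (\<lambda>w. \<Prod>j\<in>J. \<phi> j (w j))"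
proof (rule multilinear_onI)
  fix x y :: "'a \<Rightarrow> 'b" assume "\<And>i. i \<in> J \<Longrightarrow> x i = y i"
  then show "(\<Prod>j\<in>J. \<phi> j (x j)) = (\<Prod>j\<in>J. \<phi> j (y j))" by simp
next
  fix x i a b assume *: "i \<in> J" "a \<in> W i" "b \<in> W i"
  have "(\<Prod>j\<in>J. \<phi> j ((x(i := c)) j)) = \<phi> i c * (\<Prod>j\<in>J - {i}. \<phi> j (x j))" for c
    using assms(1) *(1) by (simp add: prod.remove)
  moreover have "\<phi> i (a + b) = \<phi> i a + \<phi> i b"
    using assms(2)[OF *(1)] * by (auto simp: topological_dual_def)
  ultimately show "(\<Prod>j\<in>J. \<phi> j ((x(i := a + b)) j)) =
      (\<Prod>j\<in>J. \<phi> j ((x(i := a)) j)) + (\<Prod>j\<in>J. \<phi> j ((x(i := b)) j))"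
    by (simp add: algebra_simps)
next
  fix x i c a assume *: "i \<in> J" "a \<in> W i"
  have "(\<Prod>j\<in>J. \<phi> j ((x(i := c)) j)) = \<phi> i c * (\<Prod>j\<in>J - {i}. \<phi> j (x j))" for c
    using assms(1) *(1) by (simp add: prod.remove)
  moreover have "\<phi> i (c *\<^sub>R a) = c * \<phi> i a"
    using assms(2)[OF *(1)] * by (auto simp: topological_dual_def)
  ultimately show "(\<Prod>j\<in>J. \<phi> j ((x(i := c *\<^sub>R a)) j)) = c *\<^sub>R (\<Prod>j\<in>J. \<phi> j ((x(i := a)) j))"
    by (simp add: algebra_simps)
qed

lemma multilinear_on_tensor_functional:
  assumes J: "finite J" and W: "\<And>j. j \<in> J \<Longrightarrow> subspace (W j)"
  shows "multilinear_on J (\<lambda>j. topological_dual (W j) (N j))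
           (\<lambda>\<phi>. tensor_lift J W (\<lambda>w. \<Prod>j\<in>J. \<phi> j (w j)))"
proof (rule multilinear_onI)
  fix x y :: "'a \<Rightarrow> 'b \<Rightarrow> real" assume "\<And>i. i \<in> J \<Longrightarrow> x i = y i"
  then have "(\<lambda>w. \<Prod>j\<in>J. x j (w j)) = (\<lambda>w. \<Prod>j\<in>J. y j (w j))" by simp
  then show "tensor_lift J W (\<lambda>w. \<Prod>j\<in>J. x j (w j)) = tensor_lift J W (\<lambda>w. \<Prod>j\<in>J. y j (w j))"
    by simp
next
  fix x :: "'a \<Rightarrow> 'b \<Rightarrow> real" and i a b
  assume x: "\<And>j. j \<in> J \<Longrightarrow> x j \<in> topological_dual (W j) (N j)"
    and i: "i \<in> J" and ab: "a \<in> topological_dual (W i) (N i)" "b \<in> topological_dual (W i) (N i)"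
  have prod: "(\<Prod>j\<in>J. (x(i := c)) j (w j)) = c (w i) * (\<Prod>j\<in>J - {i}. x j (w j))" for c w
    using J i by (simp add: prod.remove)
  have ml: "multilinear_on J W (\<lambda>w. \<Prod>j\<in>J. (x(i := c)) j (w j))"
    if "c \<in> topological_dual (W i) (N i)" for c
    by (rule multilinear_on_prod_functionals[where N = N, OF J]) (use x that in auto)
  have "(\<lambda>w. \<Prod>j\<in>J. (x(i := a + b)) j (w j)) =
      (\<lambda>w. (\<Prod>j\<in>J. (x(i := a)) j (w j)) + (\<Prod>j\<in>J. (x(i := b)) j (w j)))"
    unfolding prod by (simp add: algebra_simps)
  then show "tensor_lift J W (\<lambda>w. \<Prod>j\<in>J. (x(i := a + b)) j (w j)) =
      tensor_lift J W (\<lambda>w. \<Prod>j\<in>J. (x(i := a)) j (w j)) +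
      tensor_lift J W (\<lambda>w. \<Prod>j\<in>J. (x(i := b)) j (w j))"
    by (intro ext) (simp only: tensor_lift_fun_add[OF W ml[OF ab(1)] ml[OF ab(2)]] plus_fun_apply)
next
  fix x :: "'a \<Rightarrow> 'b \<Rightarrow> real" and i a and c :: real
  assume x: "\<And>j. j \<in> J \<Longrightarrow> x j \<in> topological_dual (W j) (N j)"
    and i: "i \<in> J" and a: "a \<in> topological_dual (W i) (N i)"
  have prod: "(\<Prod>j\<in>J. (x(i := c)) j (w j)) = c (w i) * (\<Prod>j\<in>J - {i}. x j (w j))" for c w
    using J i by (simp add: prod.remove)
  have ml: "multilinear_on J W (\<lambda>w. \<Prod>j\<in>J. (x(i := a)) j (w j))"
    by (rule multilinear_on_prod_functionals[where N = N, OF J]) (use x a in auto)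
  have "(\<lambda>w. \<Prod>j\<in>J. (x(i := c *\<^sub>R a)) j (w j)) =
      (\<lambda>w. c *\<^sub>R (\<Prod>j\<in>J. (x(i := a)) j (w j)))"
    unfolding prod by (simp add: scaleR_fun_def algebra_simps)
  then show "tensor_lift J W (\<lambda>w. \<Prod>j\<in>J. (x(i := c *\<^sub>R a)) j (w j)) =
      c *\<^sub>R tensor_lift J W (\<lambda>w. \<Prod>j\<in>J. (x(i := a)) j (w j))"
    by (intro ext) (simp only: tensor_lift_fun_scaleR[OF W ml] scaleR_fun_apply)
qed

lemma tensor_functional_elem:
  assumes "finite J" "\<And>j. j \<in> J \<Longrightarrow> subspace (W j)"
    and "\<And>j. j \<in> J \<Longrightarrow> \<phi> j \<in> topological_dual (W j) (N j)" "\<And>j. j \<in> J \<Longrightarrow> w j \<in> W j"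
  shows "tensor_functional J W N (elem_tensor J \<phi>) (elem_tensor J w) = (\<Prod>j\<in>J. \<phi> j (w j))"
proof -
  have "tensor_functional J W N (elem_tensor J \<phi>) = tensor_lift J W (\<lambda>w. \<Prod>j\<in>J. \<phi> j (w j))"
    unfolding tensor_functional_def
    by (rule tensor_lift_elem[OF subspace_topological_dual multilinear_on_tensor_functional[OF assms(1,2)]])
       (use assms(3) in auto)
  moreover have "tensor_lift J W (\<lambda>w. \<Prod>j\<in>J. \<phi> j (w j)) (elem_tensor J w) = (\<Prod>j\<in>J. \<phi> j (w j))"
    by (rule tensor_lift_elem[OF assms(2) multilinear_on_prod_functionals[OF assms(1,3)]])
       (use assms(4) in auto)
  ultimately show ?thesis by simp
qed

text \<open>
  \<open>id_tensor P W \<beta> f\<close> is \<open>id\<^sub>\<beta> \<otimes> f\<close> on the tensor product of the \<open>W \<gamma>\<close> over \<open>\<gamma> \<in> P\<close>,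
  for a linear functional \<open>f\<close> on the tensor product of the \<open>W \<gamma>\<close> over \<open>\<gamma> \<in> P - {\<beta>}\<close>.
\<close>

definition id_tensor ::
  "'i set \<Rightarrow> ('i \<Rightarrow> 'a::real_vector set) \<Rightarrow> 'i \<Rightarrow> (('i, 'a) tensor \<Rightarrow> real) \<Rightarrow>
   ('i, 'a) tensor \<Rightarrow> 'a" where
  "id_tensor P W \<beta> f = tensor_lift P W (\<lambda>w. f (elem_tensor (P - {\<beta>}) w) *\<^sub>R w \<beta>)"

lemma id_tensor_elem:
  assumes "\<beta> \<in> P" "\<And>\<gamma>. \<gamma> \<in> P \<Longrightarrow> subspace (W \<gamma>)" "\<And>\<gamma>. \<gamma> \<in> P \<Longrightarrow> w \<gamma> \<in> W \<gamma>"
    and add: "\<And>s t. s \<in> tensor_product (P - {\<beta>}) W \<Longrightarrow> t \<in> tensor_product (P - {\<beta>}) W \<Longrightarrow>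
      f (s + t) = f s + f t"
    and scale: "\<And>c t. t \<in> tensor_product (P - {\<beta>}) W \<Longrightarrow> f (c *\<^sub>R t) = c * f t"
  shows "id_tensor P W \<beta> f (elem_tensor P w) = f (elem_tensor (P - {\<beta>}) w) *\<^sub>R w \<beta>"
proof -
  have mem: "elem_tensor (P - {\<beta>}) x \<in> tensor_product (P - {\<beta>}) W"
    if "\<And>\<gamma>. \<gamma> \<in> P \<Longrightarrow> x \<gamma> \<in> W \<gamma>" for x
    unfolding tensor_product_def using that by (intro span_base) auto
  have same: "elem_tensor (P - {\<beta>}) (x(\<beta> := a)) = elem_tensor (P - {\<beta>}) x" for x a
    by (rule elem_tensor_cong) auto
  have "multilinear_on P W (\<lambda>w. f (elem_tensor (P - {\<beta>}) w) *\<^sub>R w \<beta>)"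
  proof (rule multilinear_onI)
    fix x y :: "'a \<Rightarrow> 'b" assume *: "\<And>i. i \<in> P \<Longrightarrow> x i = y i"
    then have "elem_tensor (P - {\<beta>}) x = elem_tensor (P - {\<beta>}) y"
      by (intro elem_tensor_cong) auto
    with * assms(1) show "f (elem_tensor (P - {\<beta>}) x) *\<^sub>R x \<beta> = f (elem_tensor (P - {\<beta>}) y) *\<^sub>R y \<beta>"
      by simp
  next
    fix x i a b
    assume x: "\<And>j. j \<in> P \<Longrightarrow> x j \<in> W j" and i: "i \<in> P" and ab: "a \<in> W i" "b \<in> W i"
    show "f (elem_tensor (P - {\<beta>}) (x(i := a + b))) *\<^sub>R (x(i := a + b)) \<beta> =
        f (elem_tensor (P - {\<beta>}) (x(i := a))) *\<^sub>R (x(i := a)) \<beta> +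
        f (elem_tensor (P - {\<beta>}) (x(i := b))) *\<^sub>R (x(i := b)) \<beta>"
    proof (cases "i = \<beta>")
      case True
      then show ?thesis by (simp add: same scaleR_add_right)
    next
      case False
      then have "elem_tensor (P - {\<beta>}) (x(i := a + b)) =
          elem_tensor (P - {\<beta>}) (x(i := a)) + elem_tensor (P - {\<beta>}) (x(i := b))"
        using i by (intro elem_tensor_add) auto
      moreover have "elem_tensor (P - {\<beta>}) (x(i := a)) \<in> tensor_product (P - {\<beta>}) W"
        "elem_tensor (P - {\<beta>}) (x(i := b)) \<in> tensor_product (P - {\<beta>}) W"
        using x ab by (auto intro!: mem)
      ultimately show ?thesis using False by (simp add: add scaleR_add_left)
    qed
  next
    fix x i c a
    assume x: "\<And>j. j \<in> P \<Longrightarrow> x j \<in> W j" and i: "i \<in> P" and a: "a \<in> W i"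
    show "f (elem_tensor (P - {\<beta>}) (x(i := c *\<^sub>R a))) *\<^sub>R (x(i := c *\<^sub>R a)) \<beta> =
        c *\<^sub>R (f (elem_tensor (P - {\<beta>}) (x(i := a))) *\<^sub>R (x(i := a)) \<beta>)"
    proof (cases "i = \<beta>")
      case True
      then show ?thesis by (simp add: same)
    next
      case False
      then have "elem_tensor (P - {\<beta>}) (x(i := c *\<^sub>R a)) =
          c *\<^sub>R elem_tensor (P - {\<beta>}) (x(i := a))"
        using i by (intro elem_tensor_scaleR) auto
      moreover have "elem_tensor (P - {\<beta>}) (x(i := a)) \<in> tensor_product (P - {\<beta>}) W"
        using x a by (auto intro!: mem)
      ultimately show ?thesis using False by (simp add: scale)
    qed
  qed
  from tensor_lift_elem[OF assms(2) this assms(3)] show ?thesis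
    unfolding id_tensor_def .
qed

end

theory Submission
  imports Defs
begin

text \<open>
  The minimal subspace of \<open>v\<close> at \<open>A \<subseteq> D\<close> consists of what is left of \<open>v\<close> when the factors outside \<open>A\<close>
  are contracted away by functionals.  Write \<open>slice D A \<psi>\<close> for the linear map \<open>id\<^sub>A \<otimes> \<psi>\<close>, where \<open>\<psi>\<close> is
  a linear functional on the tensor product over \<open>D - A\<close>.  Every subspace \<open>U\<close> with
  \<open>v \<in> U \<otimes> V\<^sub>D\<^sub>-\<^sub>A\<close> contains all slices of \<open>v\<close>.  Conversely, let \<open>F\<close> be a family of functionals that
  separates the points of the tensor product over \<open>D - A\<close>, let \<open>S\<close> be the span of the slices
  of \<open>v\<close> by members of \<open>F\<close>, and let \<open>p\<close> be a linear projection onto \<open>S\<close>.  The slices of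
  \<open>v - (p \<otimes> id) v\<close> by \<open>F\<close> are all zero, so this tensor is zero and
  \<open>v \<in> S \<otimes> V\<^sub>D\<^sub>-\<^sub>A\<close>.  So \<open>S\<close> is the minimal subspace, whichever separating
  family was chosen; this is \<open>min_subspace_eq_span_slices\<close>.

  The freedom in \<open>F\<close> yields the proposition.  For \<open>A \<subseteq> B \<subseteq> D\<close>, slicing by \<open>\<psi>\<close> on \<open>D - B\<close> and then by
  \<open>\<Psi>\<close> on \<open>B - A\<close> is slicing by \<open>\<Psi> \<otimes> \<psi>\<close>, and products of separating families separate
  (\<open>slices_separate\<close>).  Hence the minimal subspace at \<open>A\<close> is spanned by the slices of the elements
  of the minimal subspace at \<open>B\<close> by any family that separates the tensor product over \<open>B - A\<close>
  (\<open>min_subspace_nested\<close>).  With \<open>A = \<beta>\<close> and \<open>B = \<alpha>\<close>, it remains to see that the tensors in the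
  product of the topological duals separate the tensor product over \<open>\<alpha> - \<beta>\<close>
  (\<open>dual_tensors_separate\<close>): the dual of each normed space separates its points by the Hahn-Banach
  theorem, and this passes to products over the blocks by induction on the number of blocks.

  Everything rests on the fact that products of linear functionals separate the points of an
  algebraic tensor product (\<open>product_functionals_separate\<close>), which is seen in a basis.
\<close>

section \<open>Linear maps on tensor products\<close>

lemma multilinear_on_linear_compose:
  assumes "multilinear_on I V M" "linear f"
  shows "multilinear_on I V (\<lambda>x. f (M x))"
proof (rule multilinear_onI)
  show "f (M x) = f (M y)" if "\<And>i. i \<in> I \<Longrightarrow> x i = y i" for x y
    using multilinear_on_cong[OF assms(1) that] by simp
qed (simp_all add: multilinear_on_add[OF assms(1)] multilinear_on_scaleR[OF assms(1)]
      linear_add[OF assms(2)] linear_cmul[OF assms(2)])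

text \<open>
  Updating one coordinate changes only one of the two factors, because they depend on disjoint
  sets of coordinates.  All multilinear maps that are needed below, such as \<open>\<psi> \<otimes> id\<close> and products
  of functionals, arise from simpler ones in this way.
\<close>

lemma multilinear_on_scaleR_disjoint:
  fixes f :: "('i \<Rightarrow> 'a::real_vector) \<Rightarrow> real" and M :: "('i \<Rightarrow> 'a) \<Rightarrow> 'b::real_vector"
  assumes f: "multilinear_on A V f" and M: "multilinear_on B V M" and disj: "A \<inter> B = {}"
  shows "multilinear_on (A \<union> B) V (\<lambda>x. f x *\<^sub>R M x)"
proof -
  have fB: "f (x(i := a)) = f x" if "i \<in> B" for x i a
    by (rule multilinear_on_cong[OF f]) (use disj that in auto)
  have MA: "M (x(i := a)) = M x" if "i \<in> A" for x i a
    by (rule multilinear_on_cong[OF M]) (use disj that in auto)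
  show ?thesis
  proof (rule multilinear_onI)
    fix x y :: "'i \<Rightarrow> 'a" assume "\<And>i. i \<in> A \<union> B \<Longrightarrow> x i = y i"
    then show "f x *\<^sub>R M x = f y *\<^sub>R M y"
      using multilinear_on_cong[OF f, of x y] multilinear_on_cong[OF M, of x y] by auto
  next
    fix x i a b assume "\<And>j. j \<in> A \<union> B \<Longrightarrow> x j \<in> V j" "i \<in> A \<union> B" "a \<in> V i" "b \<in> V i"
    then show "f (x(i := a + b)) *\<^sub>R M (x(i := a + b)) =
        f (x(i := a)) *\<^sub>R M (x(i := a)) + f (x(i := b)) *\<^sub>R M (x(i := b))"
      by (auto simp: fB MA multilinear_on_add[OF f] multilinear_on_add[OF M]
          scaleR_add_left scaleR_add_right)
  next
    fix x i c a assume "\<And>j. j \<in> A \<union> B \<Longrightarrow> x j \<in> V j" "i \<in> A \<union> B" "a \<in> V i"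
    then show "f (x(i := c *\<^sub>R a)) *\<^sub>R M (x(i := c *\<^sub>R a)) =
        c *\<^sub>R (f (x(i := a)) *\<^sub>R M (x(i := a)))"
      by (auto simp: fB MA multilinear_on_scaleR[OF f] multilinear_on_scaleR[OF M])
  qed
qed

lemma multilinear_on_prod_disjoint:
  fixes f :: "'k \<Rightarrow> ('i \<Rightarrow> 'a::real_vector) \<Rightarrow> real"
  assumes "finite K" "\<And>k. k \<in> K \<Longrightarrow> multilinear_on (A k) V (f k)" "disjoint_family_on A K"
  shows "multilinear_on (\<Union>k\<in>K. A k) V (\<lambda>x. \<Prod>k\<in>K. f k x)"
  using assms
proof (induction K)
  case empty
  then show ?case by (simp add: multilinear_on_def)
next
  case (insert k K)
  have "disjoint_family_on A K" "A k \<inter> (\<Union>k\<in>K. A k) = {}"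
    using insert.prems(2) insert.hyps unfolding disjoint_family_on_def by auto
  then have "multilinear_on (A k \<union> (\<Union>k\<in>K. A k)) V (\<lambda>x. f k x *\<^sub>R (\<Prod>k\<in>K. f k x))"
    using insert by (intro multilinear_on_scaleR_disjoint) auto
  then show ?case using insert.hyps by simp
qed

text \<open>
  A linear map on the whole type, in contrast to \<open>tensor_lift\<close>: sums and compositions of
  such maps are again linear without side conditions on membership.
\<close>

definition linear_lift ::
  "'i set \<Rightarrow> (('i \<Rightarrow> 'a::real_vector) \<Rightarrow> 'b::real_vector) \<Rightarrow> ('i, 'a) tensor \<Rightarrow> 'b" where
  "linear_lift I M = (SOME L. linear L \<and> (\<forall>x. L (elem_tensor I x) = M x))"

lemma linear_lift:
  fixes M :: "('i \<Rightarrow> 'a::real_vector) \<Rightarrow> 'b::real_vector"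
  assumes "multilinear_on I (\<lambda>_. UNIV) M"
  shows linear_linear_lift: "linear (linear_lift I M)"
    and linear_lift_elem: "linear_lift I M (elem_tensor I x) = M x"
  using someI_ex[OF tensor_universal_UNIV[OF assms]] unfolding linear_lift_def by blast+

lemma elem_tensor_in: "(\<And>i. i \<in> I \<Longrightarrow> x i \<in> V i) \<Longrightarrow> elem_tensor I x \<in> tensor_product I V"
  unfolding tensor_product_def by (rule span_base) auto

lemma subspace_tensor_product: "subspace (tensor_product I V)"
  by (simp add: tensor_product_def)

lemma tensor_product_mono:
  "(\<And>i. i \<in> I \<Longrightarrow> V i \<subseteq> W i) \<Longrightarrow> tensor_product I V \<subseteq> tensor_product I W"
  unfolding tensor_product_def by (rule span_mono) blast

text \<open>
  The means by which the identities between linear maps below are verified: it is enough to compare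
  values at elementary tensors.
\<close>

lemma linear_eq_on_tensor_product:
  assumes "linear f" "linear g" "t \<in> tensor_product I V"
    and "\<And>x. (\<And>i. i \<in> I \<Longrightarrow> x i \<in> V i) \<Longrightarrow> f (elem_tensor I x) = g (elem_tensor I x)"
  shows "f t = g t"
  by (rule linear_eq_on_span[OF assms(1,2) _ assms(3)[unfolded tensor_product_def]])
     (use assms(4) in auto)

lemma linear_tensor_product_into:
  assumes "linear f" "subspace S" "t \<in> tensor_product I V"
    and "\<And>x. (\<And>i. i \<in> I \<Longrightarrow> x i \<in> V i) \<Longrightarrow> f (elem_tensor I x) \<in> S"
  shows "f t \<in> S"
  using assms(3) unfolding tensor_product_def
proof (induction rule: span_induct)
  case base
  show ?case using linear_subspace_vimage[OF assms(1,2)] by (simp add: vimage_def)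
next
  case (step t)
  then show ?case using assms(4) by auto
qed

section \<open>Separating families of product functionals\<close>

definition separates :: "('a \<Rightarrow> real) set \<Rightarrow> 'a::real_vector set \<Rightarrow> bool" where
  "separates F S \<longleftrightarrow> (\<forall>t\<in>S. (\<forall>f\<in>F. f t = 0) \<longrightarrow> t = 0)"

lemma separatesI: "(\<And>t. t \<in> S \<Longrightarrow> (\<And>f. f \<in> F \<Longrightarrow> f t = 0) \<Longrightarrow> t = 0) \<Longrightarrow> separates F S"
  unfolding separates_def by blast

lemma separatesD: "separates F S \<Longrightarrow> t \<in> S \<Longrightarrow> (\<And>f. f \<in> F \<Longrightarrow> f t = 0) \<Longrightarrow> t = 0"
  unfolding separates_def by blast

lemma linear_functionals_separate: "separates (Collect linear) (S :: 'a::real_vector set)"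
proof (rule separatesI)
  fix t :: 'a assume 0: "\<And>f :: 'a \<Rightarrow> real. f \<in> Collect linear \<Longrightarrow> f t = 0"
  show "t = 0"
  proof (rule ccontr)
    assume "t \<noteq> 0"
    then have "independent {t}" by simp
    from linear_independent_extend[OF this, of "\<lambda>_. 1 :: real"]
    obtain g :: "'a \<Rightarrow> real" where "linear g" "g t = 1" by auto
    with 0[of g] show False by simp
  qed
qed

definition product_functional ::
  "'i set \<Rightarrow> ('i \<Rightarrow> 'a::real_vector \<Rightarrow> real) \<Rightarrow> ('i, 'a) tensor \<Rightarrow> real" where
  "product_functional I \<phi> = linear_lift I (\<lambda>x. \<Prod>i\<in>I. \<phi> i (x i))"

lemma product_functional:
  assumes "finite I" "\<And>i. i \<in> I \<Longrightarrow> linear (\<phi> i)"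
  shows linear_product_functional: "linear (product_functional I \<phi>)"
    and product_functional_elem: "product_functional I \<phi> (elem_tensor I x) = (\<Prod>i\<in>I. \<phi> i (x i))"
proof -
  have "multilinear_on (\<Union>i\<in>I. {i}) (\<lambda>_. UNIV) (\<lambda>x. \<Prod>i\<in>I. \<phi> i (x i))"
    by (rule multilinear_on_prod_disjoint)
       (use assms in \<open>auto simp: multilinear_on_def disjoint_family_on_def linear_add linear_cmul\<close>)
  then have "multilinear_on I (\<lambda>_. UNIV) (\<lambda>x. \<Prod>i\<in>I. \<phi> i (x i))" by simp
  from linear_lift[OF this] show "linear (product_functional I \<phi>)"
    "product_functional I \<phi> (elem_tensor I x) = (\<Prod>i\<in>I. \<phi> i (x i))"
    unfolding product_functional_def .
qed

lemma linear_elem_tensor_upd: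
  assumes "i \<in> I"
  shows "linear (\<lambda>a. elem_tensor I (x(i := a)))"
  using assms by (intro linearI elem_tensor_add elem_tensor_scaleR)

text \<open>
  The coordinates in \<open>J\<close> are those not yet known to be basis vectors.  They are expanded in the
  basis one at a time; \<open>elem_tensor I x\<close> is linear in each coordinate.
\<close>

lemma elem_tensor_in_span_basis:
  assumes "finite J" "J \<subseteq> I" "span B = UNIV" "\<And>i. i \<in> I - J \<Longrightarrow> x i \<in> B"
  shows "elem_tensor I x \<in> span {elem_tensor I f | f. \<forall>i\<in>I. f i \<in> B}"
  using assms
proof (induction J arbitrary: x)
  case empty
  then show ?case by (intro span_base) auto
next
  case (insert j J)
  let ?E = "span {elem_tensor I f | f. \<forall>i\<in>I. f i \<in> B}"
  let ?h = "\<lambda>a. elem_tensor I (x(j := a))"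
  have lin: "linear ?h" using insert.prems by (intro linear_elem_tensor_upd) auto
  have "?h b \<in> ?E" if "b \<in> B" for b
    by (rule insert.IH) (use insert.prems that in auto)
  then have "?h ` span B \<subseteq> ?E"
    unfolding linear_span_image[OF lin, symmetric] by (intro span_minimal) auto
  then have "?h (x j) \<in> ?E" unfolding insert.prems(2) by (rule subsetD) (rule rangeI)
  then show ?case by simp
qed

text \<open>
  In a basis \<open>B\<close> of the underlying space, \<open>t\<close> is a combination of elementary tensors of
  basis vectors, and the product of the coordinate functionals at \<open>f i\<close>, \<open>i \<in> I\<close>, reads off the
  coefficient at \<open>elem_tensor I f\<close>.
\<close>

lemma product_functionals_separate:
  fixes I :: "'i set"
  assumes "finite I"
  shows "separates {product_functional I \<phi> | \<phi>. \<forall>i\<in>I. linear (\<phi> i)}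
    (tensor_product I (\<lambda>_. UNIV :: 'a::real_vector set))"
proof (rule separatesI)
  fix t :: "('i, 'a) tensor"
  assume t: "t \<in> tensor_product I (\<lambda>_. UNIV)"
    and 0: "\<And>f. f \<in> {product_functional I \<phi> | \<phi>. \<forall>i\<in>I. linear (\<phi> i)} \<Longrightarrow> f t = 0"
  obtain B :: "'a set" where B: "B \<subseteq> UNIV" "independent B" "UNIV \<subseteq> span B"
    by (rule maximal_independent_subset)
  then have spanB: "span B = UNIV" by auto
  \<comment> \<open>\<open>co b\<close> is the coordinate functional of the basis vector \<open>b\<close>.\<close>
  have "\<exists>g. linear g \<and> (\<forall>x\<in>B. g x = (if x = b then 1 else 0 :: real))" for b
    by (rule linear_independent_extend[OF B(2)])
  then obtain co :: "'a \<Rightarrow> 'a \<Rightarrow> real" where co: "\<And>b. linear (co b)"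
    "\<And>b x. x \<in> B \<Longrightarrow> co b x = (if x = b then 1 else 0)"
    by metis
  let ?E = "{elem_tensor I f | f. \<forall>i\<in>I. f i \<in> B}"
  have "tensor_product I (\<lambda>_. UNIV) \<subseteq> span ?E"
    unfolding tensor_product_def
    by (rule span_minimal) (use elem_tensor_in_span_basis[OF assms order_refl spanB] in auto)
  then have "t \<in> span ?E" using t by (rule subsetD)
  then have "\<exists>A r. t = (\<Sum>e\<in>A. r e *\<^sub>R e) \<and> finite A \<and> A \<subseteq> ?E"
    unfolding span_explicit by (rule CollectD)
  then obtain A r where tA: "t = (\<Sum>e\<in>A. r e *\<^sub>R e)" and A: "finite A" "A \<subseteq> ?E"
    by (elim exE conjE)
  have "r e = 0" if "e \<in> A" for e
  proof -
    from that A obtain f where e: "e = elem_tensor I f" and f: "\<forall>i\<in>I. f i \<in> B" by auto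
    let ?\<Phi> = "product_functional I (\<lambda>i. co (f i))"
    have lin: "linear ?\<Phi>" by (rule linear_product_functional[OF assms co(1)])
    have \<Phi>e: "?\<Phi> e' = (if e' = e then 1 else 0)" if "e' \<in> A" for e'
    proof -
      from that A obtain g where e': "e' = elem_tensor I g" and g: "\<forall>i\<in>I. g i \<in> B" by auto
      have v: "?\<Phi> e' = (\<Prod>i\<in>I. if g i = f i then 1 else 0)"
        unfolding e' product_functional_elem[OF assms co(1)]
        by (rule prod.cong) (use co(2) g in auto)
      show ?thesis
      proof (cases "\<forall>i\<in>I. g i = f i")
        case True
        then have "e' = e" unfolding e e' by (intro elem_tensor_cong) auto
        with True v show ?thesis by simp
      next
        case False
        then have "?\<Phi> e' = 0" unfolding v using assms by (intro prod_zero) auto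
        moreover have "?\<Phi> e = 1"
          unfolding e product_functional_elem[OF assms co(1)] using co(2) f by simp
        ultimately show ?thesis by auto
      qed
    qed
    have "0 = ?\<Phi> t" by (rule 0[symmetric]) (use co(1) in blast)
    also have "\<dots> = (\<Sum>e'\<in>A. r e' * ?\<Phi> e')"
      unfolding tA by (simp add: linear_sum[OF lin] linear_cmul[OF lin])
    also have "\<dots> = (\<Sum>e'\<in>A. if e' = e then r e else 0)"
      by (rule sum.cong) (auto simp: \<Phi>e)
    also have "\<dots> = r e" using A(1) that by simp
    finally show "r e = 0" by simp
  qed
  then show "t = 0" unfolding tA by simp
qed

section \<open>Slices of a tensor\<close>

text \<open>
  This is \<open>id\<^sub>A \<otimes> \<psi>\<close> on the tensor product over \<open>D\<close>, where \<open>\<psi>\<close> acts on the tensor product over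
  \<open>D - A\<close>.
\<close>

definition slice ::
  "'i set \<Rightarrow> 'i set \<Rightarrow> (('i, 'a::real_vector) tensor \<Rightarrow> real) \<Rightarrow> ('i, 'a) tensor \<Rightarrow> ('i, 'a) tensor"
  where "slice D A \<psi> =
    linear_lift D (\<lambda>x. \<psi> (elem_tensor (D - A) x) *\<^sub>R elem_tensor A x)"

lemma slice:
  assumes "A \<subseteq> D" "linear \<psi>"
  shows linear_slice: "linear (slice D A \<psi>)"
    and slice_elem:
      "slice D A \<psi> (elem_tensor D x) = \<psi> (elem_tensor (D - A) x) *\<^sub>R elem_tensor A x"
proof -
  have "multilinear_on (D - A \<union> A) (\<lambda>_. UNIV)
      (\<lambda>x. \<psi> (elem_tensor (D - A) x) *\<^sub>R elem_tensor A x)"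
    by (intro multilinear_on_scaleR_disjoint multilinear_on_elem_tensor
        multilinear_on_linear_compose[OF multilinear_on_elem_tensor assms(2)]) auto
  then have "multilinear_on D (\<lambda>_. UNIV) (\<lambda>x. \<psi> (elem_tensor (D - A) x) *\<^sub>R elem_tensor A x)"
    using assms(1) by (simp add: Un_absorb2)
  from linear_lift[OF this] show "linear (slice D A \<psi>)"
    "slice D A \<psi> (elem_tensor D x) = \<psi> (elem_tensor (D - A) x) *\<^sub>R elem_tensor A x"
    unfolding slice_def .
qed

lemma slice_in:
  assumes "A \<subseteq> D" "linear \<psi>" "t \<in> tensor_product D V"
  shows "slice D A \<psi> t \<in> tensor_product A V"
proof (rule linear_tensor_product_into[OF linear_slice[OF assms(1,2)] subspace_tensor_product assms(3)])
  fix x assume "\<And>i. i \<in> D \<Longrightarrow> x i \<in> V i"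
  then have "elem_tensor A x \<in> tensor_product A V"
    using assms(1) by (intro elem_tensor_in) auto
  then show "slice D A \<psi> (elem_tensor D x) \<in> tensor_product A V"
    by (simp add: slice_elem[OF assms(1,2)] subspace_scale[OF subspace_tensor_product])
qed

text \<open>
  Both sides are \<open>\<phi> \<otimes> \<psi>\<close> applied to \<open>t\<close>.  This identity lets information on slices over \<open>A\<close> be
  transferred to slices over the complement of \<open>A\<close>.
\<close>

lemma functional_slice_swap:
  assumes "A \<subseteq> D" "linear \<phi>" "linear \<psi>" "t \<in> tensor_product D V"
  shows "\<phi> (slice D A \<psi> t) = \<psi> (slice D (D - A) \<phi> t)"
proof -
  have DA: "D - A \<subseteq> D" "D - (D - A) = A" using assms(1) by auto
  have "(\<phi> \<circ> slice D A \<psi>) t = (\<psi> \<circ> slice D (D - A) \<phi>) t"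
    by (rule linear_eq_on_tensor_product[OF _ _ assms(4)], (intro linear_compose linear_slice assms DA)+)
       (simp add: slice_elem[OF assms(1,3)] slice_elem[OF DA(1) assms(2)] DA(2)
          linear_cmul[OF assms(2)] linear_cmul[OF assms(3)])
  then show ?thesis by simp
qed

text \<open>
  The functional on the right-hand side is \<open>\<Psi> \<otimes> \<psi>\<close> on the tensor product over
  \<open>D - A = (B - A) \<union> (D - B)\<close>.
\<close>

lemma slice_slice:
  assumes "A \<subseteq> B" "B \<subseteq> D" "linear \<psi>" "linear \<Psi>" "t \<in> tensor_product D V"
  shows "slice B A \<Psi> (slice D B \<psi> t) = slice D A (\<Psi> \<circ> slice (D - A) (B - A) \<psi>) t"
proof -
  have s: "B - A \<subseteq> D - A" "A \<subseteq> D" "D - A - (B - A) = D - B" using assms(1,2) by auto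
  have l: "linear (\<Psi> \<circ> slice (D - A) (B - A) \<psi>)"
    by (intro linear_compose linear_slice s assms)
  have "(slice B A \<Psi> \<circ> slice D B \<psi>) t = slice D A (\<Psi> \<circ> slice (D - A) (B - A) \<psi>) t"
    by (rule linear_eq_on_tensor_product[OF _ _ assms(5)],
        (intro linear_compose linear_slice[OF s(2) l] linear_slice assms)+)
       (simp add: slice_elem[OF assms(2,3)] slice_elem[OF s(2) l, unfolded comp_def]
          slice_elem[OF s(1) assms(3)] slice_elem[OF assms(1,4)] s(3)
          linear_cmul[OF linear_slice[OF assms(1,4)]] linear_cmul[OF assms(4)] comp_def)
  then show ?thesis by simp
qed

text \<open>
  Products \<open>\<phi> \<otimes> \<psi>\<close> of two separating families separate.  If \<open>(\<phi> \<otimes> \<psi>) w = 0\<close> always, then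
  separation by \<open>F\<close> makes the slices of \<open>w\<close> by \<open>\<psi> \<in> G\<close> vanish.  Hence \<open>(\<phi> \<otimes> \<psi>) w = 0\<close> for all linear
  \<open>\<phi>\<close> and all \<open>\<psi> \<in> G\<close>, and separation by \<open>G\<close> makes the slices of \<open>w\<close> by all linear \<open>\<phi>\<close> vanish.  In
  particular all product functionals vanish at \<open>w\<close>.
\<close>

lemma slices_separate:
  fixes V :: "'i \<Rightarrow> 'a::real_vector set"
  assumes fin: "finite D" and A: "A \<subseteq> D"
    and F: "separates F (tensor_product A V)" "\<And>\<phi>. \<phi> \<in> F \<Longrightarrow> linear \<phi>"
    and G: "separates G (tensor_product (D - A) V)" "\<And>\<psi>. \<psi> \<in> G \<Longrightarrow> linear \<psi>"
  shows "separates {\<phi> \<circ> slice D A \<psi> | \<phi> \<psi>. \<phi> \<in> F \<and> \<psi> \<in> G} (tensor_product D V)"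
proof (rule separatesI)
  fix w assume w: "w \<in> tensor_product D V"
    and "\<And>f. f \<in> {\<phi> \<circ> slice D A \<psi> | \<phi> \<psi>. \<phi> \<in> F \<and> \<psi> \<in> G} \<Longrightarrow> f w = 0"
  then have 0: "\<phi> (slice D A \<psi> w) = 0" if "\<phi> \<in> F" "\<psi> \<in> G" for \<phi> \<psi>
    using that by fastforce
  have slice0: "slice D A \<psi> w = 0" if "\<psi> \<in> G" for \<psi>
    by (rule separatesD[OF F(1) slice_in[OF A G(2)[OF that] w]]) (rule 0[OF _ that])
  have slice'0: "slice D (D - A) \<phi> w = 0" if "linear \<phi>" for \<phi>
  proof (rule separatesD[OF G(1)])
    show "slice D (D - A) \<phi> w \<in> tensor_product (D - A) V"
      by (rule slice_in[OF _ that w]) auto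
    fix \<psi> assume \<psi>: "\<psi> \<in> G"
    have "\<phi> (slice D A \<psi> w) = 0" using slice0[OF \<psi>] linear_0[OF that] by simp
    then show "\<psi> (slice D (D - A) \<phi> w) = 0"
      using functional_slice_swap[OF A that G(2)[OF \<psi>] w] by simp
  qed
  show "w = 0"
  proof (rule separatesD[OF product_functionals_separate[OF fin]])
    show "w \<in> tensor_product D (\<lambda>_. UNIV)"
      using w tensor_product_mono[of D V "\<lambda>_. UNIV"] by auto
    fix f :: "('i, 'a) tensor \<Rightarrow> real"
    assume "f \<in> {product_functional D \<phi> | \<phi>. \<forall>i\<in>D. linear (\<phi> i)}"
    then obtain \<phi> where f: "f = product_functional D \<phi>" and \<phi>: "\<And>i. i \<in> D \<Longrightarrow> linear (\<phi> i)"
      by blast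
    let ?L = "product_functional A \<phi>" and ?R = "product_functional (D - A) \<phi>"
    have DA: "D - A \<subseteq> D" "D - (D - A) = A" "finite A" "finite (D - A)"
      using A fin finite_subset by auto
    have lin: "linear ?L" "linear ?R"
      using A \<phi> DA by (auto intro!: linear_product_functional)
    \<comment> \<open>A product functional over \<open>D\<close> factors into its parts over \<open>A\<close> and over \<open>D - A\<close>.\<close>
    have "f w = (?R \<circ> slice D (D - A) ?L) w"
    proof (rule linear_eq_on_tensor_product[OF _ _ w])
      show "linear f" unfolding f by (rule linear_product_functional[OF fin \<phi>])
      show "linear (?R \<circ> slice D (D - A) ?L)" by (intro linear_compose linear_slice lin DA)
      fix x
      have "(\<Prod>i\<in>D. \<phi> i (x i)) = (\<Prod>i\<in>D - A. \<phi> i (x i)) * (\<Prod>i\<in>A. \<phi> i (x i))"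
        by (rule prod.subset_diff[OF A fin])
      moreover have "?L (elem_tensor A x) = (\<Prod>i\<in>A. \<phi> i (x i))"
        by (rule product_functional_elem[OF DA(3)]) (use A \<phi> in auto)
      moreover have "?R (elem_tensor (D - A) x) = (\<Prod>i\<in>D - A. \<phi> i (x i))"
        by (rule product_functional_elem[OF DA(4)]) (use \<phi> in auto)
      ultimately show "f (elem_tensor D x) = (?R \<circ> slice D (D - A) ?L) (elem_tensor D x)"
        by (simp add: f product_functional_elem[OF fin \<phi>] slice_elem[OF DA(1) lin(1)] DA(2)
            linear_cmul[OF lin(2)])
    qed
    then show "f w = 0" by (simp add: slice'0[OF lin(1)] linear_0[OF lin(2)])
  qed
qed

section \<open>Products of functionals over the blocks of a partition\<close>

definition block_functional ::
  "'i set set \<Rightarrow> ('i set \<Rightarrow> ('i, 'a::real_vector) tensor \<Rightarrow> real) \<Rightarrow> ('i, 'a) tensor \<Rightarrow> real" where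
  "block_functional Q \<phi> = linear_lift (\<Union>Q) (\<lambda>x. \<Prod>\<gamma>\<in>Q. \<phi> \<gamma> (elem_tensor \<gamma> x))"

lemma block_functional:
  assumes "finite Q" "disjoint Q" "\<And>\<gamma>. \<gamma> \<in> Q \<Longrightarrow> linear (\<phi> \<gamma>)"
  shows linear_block_functional: "linear (block_functional Q \<phi>)"
    and block_functional_elem:
      "block_functional Q \<phi> (elem_tensor (\<Union>Q) x) = (\<Prod>\<gamma>\<in>Q. \<phi> \<gamma> (elem_tensor \<gamma> x))"
proof -
  have "multilinear_on (\<Union>\<gamma>\<in>Q. \<gamma>) (\<lambda>_. UNIV) (\<lambda>x. \<Prod>\<gamma>\<in>Q. \<phi> \<gamma> (elem_tensor \<gamma> x))"
    by (intro multilinear_on_prod_disjoint multilinear_on_linear_compose[OF multilinear_on_elem_tensor])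
       (use assms in \<open>auto simp: disjoint_family_on_def disjoint_def\<close>)
  then have "multilinear_on (\<Union>Q) (\<lambda>_. UNIV) (\<lambda>x. \<Prod>\<gamma>\<in>Q. \<phi> \<gamma> (elem_tensor \<gamma> x))" by simp
  from linear_lift[OF this] show "linear (block_functional Q \<phi>)"
    "block_functional Q \<phi> (elem_tensor (\<Union>Q) x) = (\<Prod>\<gamma>\<in>Q. \<phi> \<gamma> (elem_tensor \<gamma> x))"
    unfolding block_functional_def .
qed

text \<open>
  Induction over the blocks: the functional for \<open>insert \<gamma> Q\<close> is the product of a functional on the
  block \<open>\<gamma>\<close> and a block functional for \<open>Q\<close>, to which \<open>slices_separate\<close> applies.
\<close>

lemma block_functionals_separate:
  fixes V :: "'i \<Rightarrow> 'a::real_vector set"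
  assumes "finite Q" "disjoint Q" "\<And>\<gamma>. \<gamma> \<in> Q \<Longrightarrow> finite \<gamma>"
    and "\<And>\<gamma>. \<gamma> \<in> Q \<Longrightarrow> separates (F \<gamma>) (tensor_product \<gamma> V)"
    and "\<And>\<gamma> \<phi>. \<gamma> \<in> Q \<Longrightarrow> \<phi> \<in> F \<gamma> \<Longrightarrow> linear \<phi>"
  shows "separates {block_functional Q \<phi> | \<phi>. \<forall>\<gamma>\<in>Q. \<phi> \<gamma> \<in> F \<gamma>} (tensor_product (\<Union>Q) V)"
  using assms
proof (induction Q)
  case empty
  have "separates {product_functional {} \<phi> | \<phi>. \<forall>i\<in>{}. linear (\<phi> i)} (tensor_product {} (\<lambda>_. UNIV :: 'a set))"
    by (rule product_functionals_separate) simp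
  then show ?case
    by (simp add: block_functional_def product_functional_def tensor_product_def)
next
  case (insert \<gamma> Q)
  let ?D = "\<Union>(insert \<gamma> Q)"
  have disj: "disjoint Q" "\<gamma> \<inter> \<Union>Q = {}"
    using insert.prems(1) insert.hyps by (auto simp: disjoint_def)
  then have D: "?D - \<gamma> = \<Union>Q" "\<gamma> \<subseteq> ?D" by auto
  let ?G = "{block_functional Q \<phi> | \<phi>. \<forall>\<gamma>\<in>Q. \<phi> \<gamma> \<in> F \<gamma>}"
  have G: "separates ?G (tensor_product (?D - \<gamma>) V)"
    unfolding D by (rule insert.IH[OF disj(1)]; rule insert.prems; simp)
  have linG: "linear \<psi>" if "\<psi> \<in> ?G" for \<psi>
    using that insert.prems(4) by (auto intro!: linear_block_functional insert.hyps disj)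
  have sep: "separates {\<mu> \<circ> slice ?D \<gamma> \<psi> | \<mu> \<psi>. \<mu> \<in> F \<gamma> \<and> \<psi> \<in> ?G} (tensor_product ?D V)"
    by (rule slices_separate[OF _ D(2) _ _ G linG])
       (use insert.prems insert.hyps in auto)
  have ext: "\<exists>\<phi>'. (\<forall>\<gamma>\<in>insert \<gamma> Q. \<phi>' \<gamma> \<in> F \<gamma>) \<and>
        (\<forall>t\<in>tensor_product ?D V. block_functional (insert \<gamma> Q) \<phi>' t = \<mu> (slice ?D \<gamma> (block_functional Q \<phi>) t))"
    if \<mu>: "\<mu> \<in> F \<gamma>" and \<phi>: "\<forall>\<gamma>\<in>Q. \<phi> \<gamma> \<in> F \<gamma>" for \<mu> \<phi>
  proof (intro exI[of _ "\<phi>(\<gamma> := \<mu>)"] conjI ballI)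
    show "(\<phi>(\<gamma> := \<mu>)) \<delta> \<in> F \<delta>" if "\<delta> \<in> insert \<gamma> Q" for \<delta> using that \<mu> \<phi> by auto
    then have lin': "linear ((\<phi>(\<gamma> := \<mu>)) \<delta>)" if "\<delta> \<in> insert \<gamma> Q" for \<delta>
      using that insert.prems(4) by blast
    have lin: "linear \<mu>" "\<And>\<delta>. \<delta> \<in> Q \<Longrightarrow> linear (\<phi> \<delta>)" using \<mu> \<phi> insert.prems(4) by auto
    have blk: "linear (block_functional Q \<phi>)"
      by (rule linear_block_functional[OF insert.hyps(1) disj(1) lin(2)])
    have blk_elem: "block_functional Q \<phi> (elem_tensor (\<Union>Q) x) = (\<Prod>\<delta>\<in>Q. \<phi> \<delta> (elem_tensor \<delta> x))" for x
      by (rule block_functional_elem[OF insert.hyps(1) disj(1) lin(2)])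
    have fin: "finite (insert \<gamma> Q)" using insert.hyps by simp
    have blk': "linear (block_functional (insert \<gamma> Q) (\<phi>(\<gamma> := \<mu>)))"
      by (rule linear_block_functional[OF fin insert.prems(1) lin'])
    fix t assume t: "t \<in> tensor_product ?D V"
    have "block_functional (insert \<gamma> Q) (\<phi>(\<gamma> := \<mu>)) t = (\<mu> \<circ> slice ?D \<gamma> (block_functional Q \<phi>)) t"
    proof (rule linear_eq_on_tensor_product[OF blk' _ t])
      show "linear (\<mu> \<circ> slice ?D \<gamma> (block_functional Q \<phi>))"
        by (intro linear_compose linear_slice D lin blk)
      fix x
      have "(\<Prod>\<delta>\<in>Q. (\<phi>(\<gamma> := \<mu>)) \<delta> (elem_tensor \<delta> x)) = (\<Prod>\<delta>\<in>Q. \<phi> \<delta> (elem_tensor \<delta> x))"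
        using insert.hyps by (intro prod.cong) auto
      moreover have "block_functional (insert \<gamma> Q) (\<phi>(\<gamma> := \<mu>)) (elem_tensor ?D x) =
          (\<Prod>\<delta>\<in>insert \<gamma> Q. (\<phi>(\<gamma> := \<mu>)) \<delta> (elem_tensor \<delta> x))"
        by (rule block_functional_elem[OF fin insert.prems(1) lin'])
      moreover have "slice ?D \<gamma> (block_functional Q \<phi>) (elem_tensor ?D x) =
          (\<Prod>\<delta>\<in>Q. \<phi> \<delta> (elem_tensor \<delta> x)) *\<^sub>R elem_tensor \<gamma> x"
        unfolding slice_elem[OF D(2) blk] D(1) blk_elem ..
      ultimately show "block_functional (insert \<gamma> Q) (\<phi>(\<gamma> := \<mu>)) (elem_tensor ?D x) =
          (\<mu> \<circ> slice ?D \<gamma> (block_functional Q \<phi>)) (elem_tensor ?D x)"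
        using insert.hyps by (simp add: linear_cmul[OF lin(1)])
    qed
    then show "block_functional (insert \<gamma> Q) (\<phi>(\<gamma> := \<mu>)) t = \<mu> (slice ?D \<gamma> (block_functional Q \<phi>) t)"
      by simp
  qed
  show ?case
  proof (rule separatesI)
    fix t assume t: "t \<in> tensor_product ?D V"
      and 0: "\<And>f. f \<in> {block_functional (insert \<gamma> Q) \<phi> | \<phi>. \<forall>\<gamma>\<in>insert \<gamma> Q. \<phi> \<gamma> \<in> F \<gamma>} \<Longrightarrow> f t = 0"
    show "t = 0"
    proof (rule separatesD[OF sep t])
      fix f assume "f \<in> {\<mu> \<circ> slice ?D \<gamma> \<psi> | \<mu> \<psi>. \<mu> \<in> F \<gamma> \<and> \<psi> \<in> ?G}"
      then obtain \<mu> \<phi> where f: "f = \<mu> \<circ> slice ?D \<gamma> (block_functional Q \<phi>)"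
        and "\<mu> \<in> F \<gamma>" "\<forall>\<gamma>\<in>Q. \<phi> \<gamma> \<in> F \<gamma>" by blast
      from ext[OF this(2,3)] obtain \<phi>' where \<phi>': "\<forall>\<gamma>\<in>insert \<gamma> Q. \<phi>' \<gamma> \<in> F \<gamma>"
        "block_functional (insert \<gamma> Q) \<phi>' t = f t" using t f by auto
      have "block_functional (insert \<gamma> Q) \<phi>' t = 0" by (rule 0) (use \<phi>'(1) in blast)
      then show "f t = 0" using \<phi>'(2) by simp
    qed
  qed
qed

section \<open>Regrouping, contractions and componentwise maps\<close>

text \<open>
  The extension of \<open>regroup Q\<close>, restricted to the tensor product over \<open>\<Union>Q\<close>, to a map that is linear
  on the whole type.
\<close>

definition linear_regroup ::
  "'i set set \<Rightarrow> ('i, 'a::real_vector) tensor \<Rightarrow> ('i set, ('i, 'a) tensor) tensor" where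
  "linear_regroup Q = linear_lift (\<Union>Q) (\<lambda>x. elem_tensor Q (\<lambda>\<gamma>. elem_tensor \<gamma> x))"

lemma linear_regroup:
  fixes t :: "('i, 'a::real_vector) tensor"
  assumes "disjoint Q"
  shows linear_linear_regroup:
      "linear (linear_regroup Q :: ('i, 'a) tensor \<Rightarrow> ('i set, ('i, 'a) tensor) tensor)"
    and linear_regroup_elem:
      "linear_regroup Q (elem_tensor (\<Union>Q) x) =
        (elem_tensor Q (\<lambda>\<gamma>. elem_tensor \<gamma> x) :: ('i set, ('i, 'a) tensor) tensor)"
    and regroup_eq_linear_regroup:
      "t \<in> tensor_product (\<Union>Q) V \<Longrightarrow> regroup Q t = linear_regroup Q t"
proof -
  note * = linear_lift[OF multilinear_on_regroup[OF assms], folded linear_regroup_def]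
  show 1: "linear (linear_regroup Q :: ('i, 'a) tensor \<Rightarrow> ('i set, ('i, 'a) tensor) tensor)"
    and 2: "linear_regroup Q (elem_tensor (\<Union>Q) x) =
        (elem_tensor Q (\<lambda>\<gamma>. elem_tensor \<gamma> x) :: ('i set, ('i, 'a) tensor) tensor)" for x
    by (rule *)+
  assume "t \<in> tensor_product (\<Union>Q) V"
  then have "t \<in> tensor_product (\<Union>Q) (\<lambda>_. UNIV)"
    using tensor_product_mono[of "\<Union>Q" V "\<lambda>_. UNIV"] by auto
  then show "regroup Q t = linear_regroup Q t"
    unfolding regroup_def by (intro tensor_lift_eqI 1 2)
qed

lemma linear_regroup_in:
  assumes "disjoint Q" "t \<in> tensor_product (\<Union>Q) V"
  shows "linear_regroup Q t \<in> tensor_product Q (\<lambda>\<gamma>. tensor_product \<gamma> V)"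
proof (rule linear_tensor_product_into[OF linear_linear_regroup[OF assms(1)] subspace_tensor_product assms(2)])
  fix x assume "\<And>i. i \<in> \<Union>Q \<Longrightarrow> x i \<in> V i"
  then show "linear_regroup Q (elem_tensor (\<Union>Q) x) \<in> tensor_product Q (\<lambda>\<gamma>. tensor_product \<gamma> V)"
    unfolding linear_regroup_elem[OF assms(1)] by (intro elem_tensor_in) auto
qed

lemma multilinear_on_single:
  "linear f \<Longrightarrow> multilinear_on {i} V (\<lambda>x. f (x i))"
  by (auto simp: multilinear_on_def linear_add linear_cmul)

text \<open>
  The map \<open>id\<^sub>i \<otimes> g\<close> of \<open>id_tensor\<close>, but linear on the whole type and without
  reference to subspaces.
\<close>

definition contract ::
  "'i set \<Rightarrow> 'i \<Rightarrow> (('i, 'a::real_vector) tensor \<Rightarrow> real) \<Rightarrow> ('i, 'a) tensor \<Rightarrow> 'a" where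
  "contract I i g = linear_lift I (\<lambda>y. g (elem_tensor (I - {i}) y) *\<^sub>R y i)"

lemma contract:
  assumes "i \<in> I" "linear g"
  shows linear_contract: "linear (contract I i g)"
    and contract_elem: "contract I i g (elem_tensor I y) = g (elem_tensor (I - {i}) y) *\<^sub>R y i"
proof -
  have "multilinear_on (I - {i} \<union> {i}) (\<lambda>_. UNIV) (\<lambda>y. g (elem_tensor (I - {i}) y) *\<^sub>R y i)"
    by (intro multilinear_on_scaleR_disjoint multilinear_on_single[OF linear_ident]
        multilinear_on_linear_compose[OF multilinear_on_elem_tensor assms(2)]) auto
  then have "multilinear_on I (\<lambda>_. UNIV) (\<lambda>y. g (elem_tensor (I - {i}) y) *\<^sub>R y i)"
    using assms(1) by (simp add: insert_absorb)
  from linear_lift[OF this] show "linear (contract I i g)"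
    "contract I i g (elem_tensor I y) = g (elem_tensor (I - {i}) y) *\<^sub>R y i"
    unfolding contract_def .
qed

definition tensor_map ::
  "'i set \<Rightarrow> ('i \<Rightarrow> 'a::real_vector \<Rightarrow> 'a) \<Rightarrow> ('i, 'a) tensor \<Rightarrow> ('i, 'a) tensor" where
  "tensor_map I p = linear_lift I (\<lambda>y. elem_tensor I (\<lambda>i. p i (y i)))"

lemma tensor_map:
  fixes p :: "'i \<Rightarrow> 'a::real_vector \<Rightarrow> 'a"
  assumes "\<And>i. i \<in> I \<Longrightarrow> linear (p i)"
  shows linear_tensor_map: "linear (tensor_map I p)"
    and tensor_map_elem: "tensor_map I p (elem_tensor I y) = elem_tensor I (\<lambda>i. p i (y i))"
proof -
  have upd: "(\<lambda>j. p j ((y(i := a)) j)) = (\<lambda>j. p j (y j))(i := p i a)" for y i a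
    by auto
  have "multilinear_on I (\<lambda>_. UNIV) (\<lambda>y. elem_tensor I (\<lambda>i. p i (y i)))"
  proof (rule multilinear_onI)
    show "elem_tensor I (\<lambda>i. p i (x i)) = elem_tensor I (\<lambda>i. p i (y i))"
      if "\<And>i. i \<in> I \<Longrightarrow> x i = y i" for x y
      by (rule elem_tensor_cong) (simp add: that)
  qed (simp_all only: upd linear_add[OF assms] linear_cmul[OF assms] elem_tensor_add elem_tensor_scaleR)
  from linear_lift[OF this] show "linear (tensor_map I p)"
    "tensor_map I p (elem_tensor I y) = elem_tensor I (\<lambda>i. p i (y i))"
    unfolding tensor_map_def .
qed

section \<open>Minimal subspaces as spans of slices\<close>

text \<open>
  The definition of the minimal subspace speaks about \<open>v\<close> as a tensor with the two factors \<open>A\<close> and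
  \<open>D - A\<close>.  There a functional on the second factor is a functional on tensors over the
  one-element index set \<open>{D - A}\<close>.
\<close>

lemma slice_eq_contract_regroup:
  assumes "finite D" "A \<subseteq> D" "A \<noteq> D" "linear \<psi>" "v \<in> tensor_product D V"
  shows "slice D A \<psi> v =
    contract {A, D - A} A (product_functional {D - A} (\<lambda>_. \<psi>)) (linear_regroup {A, D - A} v)"
proof -
  let ?Q = "{A, D - A}" and ?f = "product_functional {D - A} (\<lambda>_. \<psi>)"
  have Q: "disjoint ?Q" "\<Union>?Q = D" "?Q - {A} = {D - A}" "A \<in> ?Q"
    using assms(2,3) by (auto simp: disjoint_def)
  have f: "linear ?f" "?f (elem_tensor {D - A} y) = \<psi> (y (D - A))" for y
    using linear_product_functional[of "{D - A}" "\<lambda>_. \<psi>"]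
      product_functional_elem[of "{D - A}" "\<lambda>_. \<psi>"] assms(4) by auto
  have "slice D A \<psi> v = (contract ?Q A ?f \<circ> linear_regroup ?Q) v"
    by (rule linear_eq_on_tensor_product[OF _ _ assms(5)],
        (intro linear_compose linear_slice linear_contract linear_linear_regroup assms Q f)+)
       (simp only: slice_elem[OF assms(2,4)] comp_apply
         linear_regroup_elem[OF Q(1), unfolded Q(2)] contract_elem[OF Q(4) f(1)] Q(3) f(2))
  then show ?thesis by simp
qed

text \<open>
  Let \<open>S\<close> be the span of the slices and \<open>p\<close> a linear projection onto \<open>S\<close>.  Since
  \<open>(p \<otimes> id) v\<close> lies in the tensor product with \<open>S\<close> as its factor at \<open>A\<close>, it suffices to prove
  \<open>v = (p \<otimes> id) v\<close>.  A product functional \<open>\<phi> \<otimes> \<chi>\<close> maps the difference to \<open>(\<theta> \<otimes> \<chi>) v\<close> with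
  \<open>\<theta> = \<phi> \<circ> (id - p)\<close>.  As \<open>\<theta>\<close> vanishes on \<open>S\<close>, we have \<open>(\<theta> \<otimes> \<psi>) v = 0\<close> for all \<open>\<psi> \<in> F\<close>, so the slice
  of \<open>v\<close> by \<open>\<theta>\<close> is zero because \<open>F\<close> separates, and therefore \<open>(\<theta> \<otimes> \<chi>) v = 0\<close>.
\<close>

lemma regroup_in_slices:
  fixes V :: "'i \<Rightarrow> 'a::real_vector set"
  assumes fin: "finite D" and A: "A \<subseteq> D" "A \<noteq> D" and v: "v \<in> tensor_product D V"
    and F: "separates F (tensor_product (D - A) V)" "\<And>\<psi>. \<psi> \<in> F \<Longrightarrow> linear \<psi>"
  shows "linear_regroup {A, D - A} v \<in> tensor_product {A, D - A}
    ((\<lambda>\<gamma>. tensor_product \<gamma> V)(A := span {slice D A \<psi> v | \<psi>. \<psi> \<in> F}))"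
proof -
  let ?Q = "{A, D - A}" and ?S = "span {slice D A \<psi> v | \<psi>. \<psi> \<in> F}"
  let ?R = "linear_regroup ?Q :: ('i, 'a) tensor \<Rightarrow> _"
  have Q: "disjoint ?Q" "\<Union>?Q = D" "finite ?Q" "A \<noteq> D - A" "D - (D - A) = A"
    using A by (auto simp: disjoint_def)
  note linR = linear_linear_regroup[OF Q(1), where 'a = 'a]
  note R_elem = linear_regroup_elem[OF Q(1), unfolded Q(2), where 'a = 'a]
  obtain p :: "('i, 'a) tensor \<Rightarrow> ('i, 'a) tensor"
    where p: "range p \<subseteq> ?S" "linear p" "\<And>s. s \<in> ?S \<Longrightarrow> p s = s"
    using linear_exists_left_inverse_on[OF linear_id subspace_span[of "{slice D A \<psi> v | \<psi>. \<psi> \<in> F}"]] by auto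
  let ?p = "(\<lambda>_ s. s)(A := p)"
  let ?T = "tensor_map ?Q ?p"
  have linp: "linear (?p \<gamma>)" for \<gamma> using p(2) linear_ident by auto
  have T: "?T (elem_tensor ?Q y) = elem_tensor ?Q (\<lambda>\<gamma>. ?p \<gamma> (y \<gamma>))" for y
    by (rule tensor_map_elem[OF linp])
  have linT: "linear ?T" by (rule linear_tensor_map[OF linp])
  have Rv: "?R v \<in> tensor_product ?Q (\<lambda>\<gamma>. tensor_product \<gamma> V)"
    by (rule linear_regroup_in[OF Q(1)]) (use v Q(2) in simp)
  have TRv: "?T (?R v) \<in> tensor_product ?Q ((\<lambda>\<gamma>. tensor_product \<gamma> V)(A := ?S))"
  proof (rule linear_tensor_product_into[OF linT subspace_tensor_product Rv])
    fix y assume "\<And>\<gamma>. \<gamma> \<in> ?Q \<Longrightarrow> y \<gamma> \<in> tensor_product \<gamma> V"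
    then show "?T (elem_tensor ?Q y) \<in> tensor_product ?Q ((\<lambda>\<gamma>. tensor_product \<gamma> V)(A := ?S))"
      unfolding T by (intro elem_tensor_in) (use p(1) Q(4) in auto)
  qed
  have U: "tensor_product ?Q W \<subseteq> tensor_product ?Q (\<lambda>_. UNIV)" for W :: "'i set \<Rightarrow> ('i, 'a) tensor set"
    by (rule tensor_product_mono) simp
  have "?R v - ?T (?R v) = 0"
  proof (rule separatesD[OF product_functionals_separate[OF Q(3)]])
    show "?R v - ?T (?R v) \<in> tensor_product ?Q (\<lambda>_. UNIV)"
      by (rule subspace_diff[OF subspace_tensor_product subsetD[OF U Rv] subsetD[OF U TRv]])
    fix f :: "('i set, ('i, 'a) tensor) tensor \<Rightarrow> real"
    assume "f \<in> {product_functional ?Q \<phi> | \<phi>. \<forall>\<gamma>\<in>?Q. linear (\<phi> \<gamma>)}"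
    then obtain \<phi> where f: "f = product_functional ?Q \<phi>" and \<phi>: "\<And>\<gamma>. \<gamma> \<in> ?Q \<Longrightarrow> linear (\<phi> \<gamma>)"
      by blast
    have linf: "linear f" unfolding f by (rule linear_product_functional[OF Q(3) \<phi>])
    have f_elem: "f (elem_tensor ?Q y) = \<phi> A (y A) * \<phi> (D - A) (y (D - A))" for y
      unfolding f using product_functional_elem[OF Q(3) \<phi>] Q(4) by simp
    have lin\<phi>: "linear (\<phi> A)" "linear (\<phi> (D - A))" using \<phi> by auto
    let ?\<theta> = "\<lambda>s. \<phi> A (s - p s)"
    have lin\<theta>: "linear ?\<theta>"
      by (rule linear_compose[OF linear_compose_sub[OF linear_ident p(2)] lin\<phi>(1), unfolded comp_def])
    have "slice D (D - A) ?\<theta> v = 0"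
    proof (rule separatesD[OF F(1)])
      show "slice D (D - A) ?\<theta> v \<in> tensor_product (D - A) V"
        by (rule slice_in[OF _ lin\<theta> v]) auto
      fix \<psi> assume \<psi>: "\<psi> \<in> F"
      then have "slice D A \<psi> v \<in> ?S" by (intro span_base) auto
      then have "?\<theta> (slice D A \<psi> v) = 0" by (simp add: p(3) linear_0[OF lin\<phi>(1)])
      then show "\<psi> (slice D (D - A) ?\<theta> v) = 0"
        using functional_slice_swap[OF A(1) lin\<theta> F(2)[OF \<psi>] v] by simp
    qed
    moreover have "(\<lambda>t. f (?R t - ?T (?R t))) v = (\<phi> (D - A) \<circ> slice D (D - A) ?\<theta>) v"
    proof (rule linear_eq_on_tensor_product[OF _ _ v])
      show "linear (\<lambda>t. f (?R t - ?T (?R t)))"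
        by (rule linear_compose[OF linear_compose_sub[OF linR linear_compose[OF linR linT]] linf,
            unfolded comp_def])
      show "linear (\<phi> (D - A) \<circ> slice D (D - A) ?\<theta>)"
        by (intro linear_compose linear_slice lin\<theta> lin\<phi>) auto
      fix x
      have "slice D (D - A) ?\<theta> (elem_tensor D x) = ?\<theta> (elem_tensor A x) *\<^sub>R elem_tensor (D - A) x"
        using slice_elem[OF _ lin\<theta>, of "D - A" D x] by (simp add: Q(5))
      then show "f (?R (elem_tensor D x) - ?T (?R (elem_tensor D x))) =
          (\<phi> (D - A) \<circ> slice D (D - A) ?\<theta>) (elem_tensor D x)"
        using Q(4) by (simp add: R_elem T linear_diff[OF linf] f_elem linear_cmul[OF lin\<phi>(2)]
            linear_diff[OF lin\<phi>(1)] left_diff_distrib)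
    qed
    ultimately show "f (?R v - ?T (?R v)) = 0" by (simp add: linear_0[OF lin\<phi>(2)])
  qed
  with TRv show ?thesis by simp
qed

text \<open>
  For \<open>A = D\<close>, the empty tensor product is the line through the nonzero empty tensor \<open>e\<close>.  The slice
  of \<open>v\<close> by \<open>\<psi>\<close> is \<open>\<psi> e\<close> times \<open>v\<close>, and some \<open>\<psi> \<in> F\<close> has \<open>\<psi> e \<noteq> 0\<close>; so the convention that the minimal
  subspace at \<open>D\<close> is the span of \<open>v\<close> is no exception.  For \<open>A \<noteq> D\<close>, the span of the slices supports \<open>v\<close>
  by \<open>regroup_in_slices\<close>, and it is the least such subspace since any \<open>U\<close> supporting \<open>v\<close> contains
  every slice of \<open>v\<close>.
\<close>

theorem min_subspace_eq_span_slices: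
  fixes V :: "'i \<Rightarrow> 'a::real_vector set"
  assumes fin: "finite D" and A: "A \<subseteq> D" and v: "v \<in> tensor_product D V"
    and F: "separates F (tensor_product (D - A) V)" "\<And>\<psi>. \<psi> \<in> F \<Longrightarrow> linear \<psi>"
  shows "min_subspace D V v A = span {slice D A \<psi> v | \<psi>. \<psi> \<in> F}" (is "_ = ?S")
proof (cases "A = D")
  case True
  let ?e = "elem_tensor {} (\<lambda>_. 0) :: ('i, 'a) tensor"
  have "product_functional {} (\<lambda>_ _. 0) ?e = 1"
    by (subst product_functional_elem) auto
  moreover have "linear (product_functional {} (\<lambda>_ _. 0) :: ('i, 'a) tensor \<Rightarrow> real)"
    by (rule linear_product_functional) auto
  ultimately have "?e \<noteq> 0" using linear_0 by force
  moreover have "?e \<in> tensor_product (D - A) V"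
    unfolding True Diff_cancel by (rule elem_tensor_in) simp
  ultimately obtain \<psi> where \<psi>: "\<psi> \<in> F" "\<psi> ?e \<noteq> 0"
    using separatesD[OF F(1)] by blast
  have s: "slice D D \<psi> v = \<psi> ?e *\<^sub>R v" if "\<psi> \<in> F" for \<psi>
  proof (rule linear_eq_on_tensor_product[OF _ _ v])
    show "linear (slice D D \<psi>)" by (rule linear_slice[OF order_refl F(2)[OF that]])
    show "linear (\<lambda>v. \<psi> ?e *\<^sub>R v :: ('i, 'a) tensor)" by (rule linear_scale_self)
    fix x :: "'i \<Rightarrow> 'a"
    have "elem_tensor (D - D) x = ?e" by (simp, rule elem_tensor_cong) simp
    then show "slice D D \<psi> (elem_tensor D x) = \<psi> ?e *\<^sub>R elem_tensor D x"
      by (simp only: slice_elem[OF order_refl F(2)[OF that]])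
  qed
  have "(1 / \<psi> ?e) *\<^sub>R slice D A \<psi> v = v" using \<psi> s True by simp
  moreover have "(1 / \<psi> ?e) *\<^sub>R slice D A \<psi> v \<in> ?S"
    by (intro span_scale span_base) (use \<psi> in blast)
  ultimately have "v \<in> ?S" by (simp only:)
  then have "span {v} \<subseteq> ?S" by (intro span_minimal) auto
  moreover have "?S \<subseteq> span {v}"
    by (rule span_minimal[OF _ subspace_span]) (use s True in \<open>auto simp: span_singleton\<close>)
  ultimately show ?thesis by (simp add: min_subspace_def True)
next
  case False
  let ?Q = "{A, D - A}" and ?W = "\<lambda>\<gamma>. tensor_product \<gamma> V"
  have Q: "disjoint ?Q" "\<Union>?Q = D" "A \<in> ?Q" "A \<noteq> D - A"
    using A False by (auto simp: disjoint_def)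
  have reg: "regroup ?Q v = linear_regroup ?Q v"
    by (rule regroup_eq_linear_regroup[OF Q(1)]) (use v Q(2) in simp)
  define supports where "supports = (\<lambda>U. subspace U \<and> U \<subseteq> tensor_product A V \<and>
      regroup ?Q v \<in> tensor_product ?Q (?W(A := U)))"
  have "?S \<subseteq> tensor_product A V"
    using slice_in[OF A F(2) v] by (intro span_minimal subspace_tensor_product) auto
  then have S: "supports ?S"
    using regroup_in_slices[OF fin A False v F] by (simp add: supports_def reg)
  have least: "?S \<subseteq> U" if "supports U" for U
  proof (rule span_minimal)
    show U: "subspace U" using that by (simp add: supports_def)
    have "slice D A \<psi> v \<in> U" if "\<psi> \<in> F" for \<psi>
    proof -
      let ?f = "product_functional {D - A} (\<lambda>_. \<psi>)"
      have f: "linear ?f" by (rule linear_product_functional) (auto simp: F(2)[OF that])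
      show ?thesis
        unfolding slice_eq_contract_regroup[OF fin A False F(2)[OF that] v]
      proof (rule linear_tensor_product_into[OF linear_contract[OF Q(3) f] U])
        show "linear_regroup ?Q v \<in> tensor_product ?Q (?W(A := U))"
          using \<open>supports U\<close> by (simp add: supports_def reg)
        fix y assume "\<And>\<gamma>. \<gamma> \<in> ?Q \<Longrightarrow> y \<gamma> \<in> (?W(A := U)) \<gamma>"
        then have "y A \<in> U" using Q(3) by fastforce
        then show "contract ?Q A ?f (elem_tensor ?Q y) \<in> U"
          by (simp only: contract_elem[OF Q(3) f] subspace_scale[OF U])
      qed
    qed
    then show "{slice D A \<psi> v | \<psi>. \<psi> \<in> F} \<subseteq> U" by blast
  qed
  have "(THE U. supports U \<and> (\<forall>W. supports W \<longrightarrow> U \<subseteq> W)) = ?S"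
    using S least by (intro the_equality) blast+
  then show ?thesis using False by (simp add: min_subspace_def supports_def)
qed

lemma min_subspace_subset:
  assumes "finite D" "A \<subseteq> D" "v \<in> tensor_product D V"
  shows "min_subspace D V v A \<subseteq> tensor_product A V"
proof -
  have "min_subspace D V v A = span {slice D A \<psi> v | \<psi>. \<psi> \<in> Collect linear}"
    by (rule min_subspace_eq_span_slices[OF assms linear_functionals_separate]) simp
  also have "\<dots> \<subseteq> tensor_product A V"
    using slice_in[OF assms(2) _ assms(3)] by (intro span_minimal subspace_tensor_product) auto
  finally show ?thesis .
qed

text \<open>
  The functionals \<open>\<Psi> \<otimes> \<psi>\<close> with \<open>\<Psi> \<in> G\<close> and \<open>\<psi>\<close> an arbitrary linear functional on the tensor product
  over \<open>D - B\<close> separate the tensor product over \<open>D - A\<close>.  The slice of \<open>v\<close> by \<open>\<Psi> \<otimes> \<psi>\<close> is the slice by \<open>\<Psi>\<close>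
  of the slice of \<open>v\<close> by \<open>\<psi>\<close>, and the latter slices span the minimal subspace at \<open>B\<close>.
\<close>

lemma min_subspace_nested:
  fixes V :: "'i \<Rightarrow> 'a::real_vector set"
  assumes D: "finite D" and AB: "A \<subseteq> B" "B \<subseteq> D" and v: "v \<in> tensor_product D V"
    and G: "separates G (tensor_product (B - A) V)" "\<And>\<Psi>. \<Psi> \<in> G \<Longrightarrow> linear \<Psi>"
  shows "min_subspace D V v A =
    span {slice B A \<Psi> u | u \<Psi>. u \<in> min_subspace D V v B \<and> \<Psi> \<in> G}"
proof -
  define U where "U = {slice D B \<psi> v | \<psi>. linear \<psi>}"
  have U: "min_subspace D V v B = span U"
    using min_subspace_eq_span_slices[OF D AB(2) v linear_functionals_separate] by (simp add: U_def)
  have s: "B - A \<subseteq> D - A" "A \<subseteq> D" using AB by auto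
  let ?F = "{\<Psi> \<circ> slice (D - A) (B - A) \<psi> | \<Psi> \<psi>. \<Psi> \<in> G \<and> \<psi> \<in> Collect linear}"
  have F: "separates ?F (tensor_product (D - A) V)"
    by (rule slices_separate[OF _ s(1) G linear_functionals_separate]) (use D in auto)
  have linF: "linear f" if "f \<in> ?F" for f
    using that by (auto intro!: linear_compose[OF linear_slice[OF s(1)] G(2)])
  have "min_subspace D V v A = span {slice D A f v | f. f \<in> ?F}"
    by (rule min_subspace_eq_span_slices[OF D s(2) v F linF])
  also have "{slice D A f v | f. f \<in> ?F} = {slice B A \<Psi> u | u \<Psi>. u \<in> U \<and> \<Psi> \<in> G}"
    unfolding U_def using slice_slice[OF AB _ G(2) v] by (auto 0 4) metis+
  also have "span \<dots> = span {slice B A \<Psi> u | u \<Psi>. u \<in> span U \<and> \<Psi> \<in> G}" (is "span ?X = span ?Y")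
  proof (rule antisym)
    show "span ?X \<subseteq> span ?Y" by (intro span_mono) (auto intro: span_base)
    show "span ?Y \<subseteq> span ?X"
    proof (rule span_minimal[OF _ subspace_span])
      have "slice B A \<Psi> u \<in> span ?X" if "u \<in> span U" "\<Psi> \<in> G" for u \<Psi>
      proof -
        have "slice B A \<Psi> ` span U = span (slice B A \<Psi> ` U)"
          by (rule linear_span_image[OF linear_slice[OF AB(1) G(2)[OF that(2)]], symmetric])
        also have "\<dots> \<subseteq> span ?X" using that(2) by (intro span_mono) auto
        finally show ?thesis using that(1) by auto
      qed
      then show "?Y \<subseteq> span ?X" by auto
    qed
  qed
  finally show ?thesis unfolding U .
qed

section \<open>The Hahn-Banach theorem\<close>

definition sublinear :: "('a::real_vector \<Rightarrow> real) \<Rightarrow> bool" where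
  "sublinear p \<longleftrightarrow> (\<forall>x y. p (x + y) \<le> p x + p y) \<and> (\<forall>c\<ge>0. \<forall>x. p (c *\<^sub>R x) = c * p x)"

lemma sublinear_add: "sublinear p \<Longrightarrow> p (x + y) \<le> p x + p y"
  and sublinear_scale: "sublinear p \<Longrightarrow> 0 \<le> c \<Longrightarrow> p (c *\<^sub>R x) = c * p x"
  by (auto simp: sublinear_def)

lemma sublinear_zero: "sublinear p \<Longrightarrow> p 0 = 0"
  using sublinear_scale[of p 0 0] by simp

lemma sublinear_minus: "sublinear p \<Longrightarrow> - p (- x) \<le> p x"
  using sublinear_add[of p x "- x"] by (simp add: sublinear_zero)

text \<open>
  The witness is \<open>q y = inf {p (y + t z) - t p z | t \<ge> 0}\<close>, the largest sublinear functional below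
  \<open>p\<close> whose value at \<open>- z\<close> is at most \<open>- p z\<close>.  It serves twice: to show that minimal sublinear
  functionals are linear, and to fix the value at \<open>z\<close> before a minimal one is chosen.
\<close>

lemma sublinear_tilt:
  assumes p: "sublinear p"
  shows "\<exists>q. sublinear q \<and> q \<le> p \<and> q (- z) \<le> - p z"
proof -
  define q where "q y = (INF t\<in>{0..}. p (y + t *\<^sub>R z) - t * p z)" for y
  have bdd: "bdd_below ((\<lambda>t. p (y + t *\<^sub>R z) - t * p z) ` {0..})" for y
  proof (rule bdd_belowI2)
    fix t :: real assume "t \<in> {0..}"
    then show "- p (- y) \<le> p (y + t *\<^sub>R z) - t * p z"
      using sublinear_add[OF p, of "y + t *\<^sub>R z" "- y"] sublinear_scale[OF p, of t z] by simp
  qed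
  have le: "q y \<le> p (y + t *\<^sub>R z) - t * p z" if "t \<ge> 0" for y t
    unfolding q_def using that by (intro cINF_lower[OF bdd]) auto
  have ge: "c \<le> q y" if "\<And>t. t \<ge> 0 \<Longrightarrow> c \<le> p (y + t *\<^sub>R z) - t * p z" for c y
    unfolding q_def using that by (intro cINF_greatest) auto
  have scale: "c * q y \<le> q (c *\<^sub>R y)" if c: "c > 0" for c y
  proof (rule ge)
    fix t :: real assume "t \<ge> 0"
    with c have "c * q y \<le> c * (p (y + (t / c) *\<^sub>R z) - (t / c) * p z)"
      by (intro mult_left_mono le) auto
    also have "\<dots> = p (c *\<^sub>R (y + (t / c) *\<^sub>R z)) - t * p z"
      using c by (simp add: sublinear_scale[OF p] right_diff_distrib)
    also have "\<dots> = p (c *\<^sub>R y + t *\<^sub>R z) - t * p z"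
      using c by (simp add: scaleR_add_right)
    finally show "c * q y \<le> p (c *\<^sub>R y + t *\<^sub>R z) - t * p z" .
  qed
  have "q 0 = 0"
  proof (rule antisym)
    show "q 0 \<le> 0" using le[of 0 0] by (simp add: sublinear_zero[OF p])
    show "0 \<le> q 0" by (rule ge) (simp add: sublinear_scale[OF p])
  qed
  have "sublinear q"
    unfolding sublinear_def
  proof (intro conjI allI impI)
    fix x y
    have step: "q (x + y) - (p (y + s *\<^sub>R z) - s * p z) \<le> p (x + t *\<^sub>R z) - t * p z"
      if "t \<ge> 0" "s \<ge> 0" for s t
    proof -
      have "q (x + y) \<le> p ((x + y) + (t + s) *\<^sub>R z) - (t + s) * p z"
        using that by (intro le) auto
      also have "(x + y) + (t + s) *\<^sub>R z = (x + t *\<^sub>R z) + (y + s *\<^sub>R z)"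
        by (simp add: scaleR_add_left algebra_simps)
      finally show ?thesis
        using sublinear_add[OF p, of "x + t *\<^sub>R z" "y + s *\<^sub>R z"] by (simp add: algebra_simps)
    qed
    have "q (x + y) - q x \<le> q y"
    proof (rule ge)
      fix s :: real assume s: "s \<ge> 0"
      have "q (x + y) - (p (y + s *\<^sub>R z) - s * p z) \<le> q x"
        using step s by (intro ge) auto
      then show "q (x + y) - q x \<le> p (y + s *\<^sub>R z) - s * p z" by linarith
    qed
    then show "q (x + y) \<le> q x + q y" by linarith
  next
    fix c :: real and x assume "0 \<le> c"
    show "q (c *\<^sub>R x) = c * q x"
    proof (cases "c = 0")
      case False
      with \<open>0 \<le> c\<close> have c: "c > 0" by simp
      have "q (c *\<^sub>R x) \<le> c * q x"
        using scale[of "1 / c" "c *\<^sub>R x"] c by (simp add: field_simps)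
      with scale[OF c, of x] show ?thesis by simp
    qed (simp add: \<open>q 0 = 0\<close>)
  qed
  moreover have "q \<le> p" using le[of 0] by (simp add: le_fun_def)
  moreover have "q (- z) \<le> - p z" using le[of 1 "- z"] by (simp add: sublinear_zero[OF p])
  ultimately show ?thesis by blast
qed

text \<open>
  By minimality, tilting \<open>p\<close> in the direction of \<open>x\<close> changes nothing, so that \<open>p (- x) \<le> - p x\<close>.
  An odd sublinear functional is linear.
\<close>

lemma sublinear_minimal_linear:
  assumes p: "sublinear p" and min: "\<And>q. sublinear q \<Longrightarrow> q \<le> p \<Longrightarrow> q = p"
  shows "linear p"
proof -
  have neg: "p (- x) = - p x" for x
  proof (rule antisym)
    obtain q where "sublinear q" "q \<le> p" "q (- x) \<le> - p x"
      using sublinear_tilt[OF p] by blast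
    with min show "p (- x) \<le> - p x" by blast
    show "- p x \<le> p (- x)" using sublinear_minus[OF p, of "- x"] by simp
  qed
  show ?thesis
  proof (rule linearI)
    fix x y
    have "- p (x + y) \<le> - p x - p y"
      using sublinear_add[OF p, of "- x" "- y"] by (metis neg minus_add_distrib diff_conv_add_uminus)
    with sublinear_add[OF p, of x y] show "p (x + y) = p x + p y" by linarith
  next
    fix c x
    show "p (c *\<^sub>R x) = c *\<^sub>R p x"
    proof (cases "c \<ge> 0")
      case False
      then have "p ((- c) *\<^sub>R x) = - c * p x" by (intro sublinear_scale[OF p]) auto
      with neg[of "c *\<^sub>R x"] show ?thesis by simp
    qed (simp add: sublinear_scale[OF p])
  qed
qed

text \<open>
  The infimum is finite since sublinear functionals below \<open>p\<close> are bounded below by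
  \<open>- p (- x)\<close> at \<open>x\<close>.  It is subadditive because, of two members of a chain, the smaller one can be
  used for both summands.
\<close>

lemma sublinear_Inf:
  assumes C: "C \<noteq> {}" "\<And>q. q \<in> C \<Longrightarrow> sublinear q" "\<And>q. q \<in> C \<Longrightarrow> q \<le> p"
    and chain: "\<And>q r. q \<in> C \<Longrightarrow> r \<in> C \<Longrightarrow> q \<le> r \<or> r \<le> q"
  shows "\<exists>u. sublinear u \<and> (\<forall>q\<in>C. u \<le> q)"
proof -
  define u where "u x = (INF q\<in>C. q x)" for x
  have bdd: "bdd_below ((\<lambda>q. q x) ` C)" for x
  proof (rule bdd_belowI2)
    fix q assume "q \<in> C"
    then show "- p (- x) \<le> q x"
      using sublinear_minus[OF C(2), of q x] C(3)[of q] by (auto simp: le_fun_def intro: order_trans[rotated])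
  qed
  have le: "u x \<le> q x" if "q \<in> C" for q x
    unfolding u_def using that by (intro cINF_lower[OF bdd])
  have ge: "c \<le> u x" if "\<And>q. q \<in> C \<Longrightarrow> c \<le> q x" for c x
    unfolding u_def using that C(1) by (intro cINF_greatest)
  have scale: "c * u x \<le> u (c *\<^sub>R x)" if "c \<ge> 0" for c x
    by (rule ge) (simp add: sublinear_scale[OF C(2)] that mult_left_mono le)
  have "sublinear u"
    unfolding sublinear_def
  proof (intro conjI allI impI)
    fix x y
    have step: "u (x + y) - r y \<le> q x" if qr: "q \<in> C" "r \<in> C" for q r
    proof -
      obtain s where s: "s \<in> C" "s \<le> q" "s \<le> r" using chain[OF qr] qr order_refl by metis
      have "u (x + y) \<le> s x + s y" using le[OF s(1)] sublinear_add[OF C(2)[OF s(1)]] order_trans by blast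
      moreover have "s x \<le> q x" "s y \<le> r y" using s by (auto simp: le_fun_def)
      ultimately show ?thesis by linarith
    qed
    have "u (x + y) - u x \<le> u y"
    proof (rule ge)
      fix r assume r: "r \<in> C"
      have "u (x + y) - r y \<le> u x" by (rule ge) (rule step[OF _ r])
      then show "u (x + y) - u x \<le> r y" by linarith
    qed
    then show "u (x + y) \<le> u x + u y" by linarith
  next
    fix c :: real and x assume "0 \<le> c"
    show "u (c *\<^sub>R x) = c * u x"
    proof (cases "c = 0")
      case True
      obtain q where "q \<in> C" using C(1) by blast
      have "u 0 = 0"
        unfolding u_def using C(1,2) by (simp add: sublinear_zero cong: INF_cong)
      then show ?thesis using True by simp
    next
      case False
      with \<open>0 \<le> c\<close> have c: "c > 0" by simp
      have "u (c *\<^sub>R x) \<le> c * u x"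
        using scale[of "1 / c" "c *\<^sub>R x"] c by (simp add: field_simps)
      with scale[of c x] c show ?thesis by simp
    qed
  qed
  with le show ?thesis by (auto simp: le_fun_def)
qed

text \<open>
  Zorn's lemma gives a minimal sublinear functional \<open>f\<close> below the tilt of \<open>p\<close> in the direction of
  \<open>z\<close>.  It is linear, and \<open>f (- z) \<le> - p z\<close> turns into \<open>f z \<ge> p z\<close>.
\<close>

theorem Hahn_Banach_sublinear:
  fixes p :: "'a::real_vector \<Rightarrow> real"
  assumes p: "sublinear p"
  shows "\<exists>f. linear f \<and> f \<le> p \<and> f z = p z"
proof -
  obtain p0 where p0: "sublinear p0" "p0 \<le> p" "p0 (- z) \<le> - p z"
    using sublinear_tilt[OF p] by blast
  define A where "A = {q. sublinear q \<and> q \<le> p0}"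
  have "\<exists>m\<in>A. \<forall>q\<in>A. m \<ge> q \<longrightarrow> q = m"
  proof (rule predicate_Zorn)
    show "partial_order_on A (relation_of (\<ge>) A)"
      by (rule partial_order_on_relation_ofI) auto
    fix C assume "C \<in> Chains (relation_of (\<ge>) A)"
    then have C: "C \<subseteq> A" "\<And>q r. q \<in> C \<Longrightarrow> r \<in> C \<Longrightarrow> q \<le> r \<or> r \<le> q"
      unfolding Chains_def relation_of_def by auto
    show "\<exists>u\<in>A. \<forall>q\<in>C. q \<ge> u"
    proof (cases "C = {}")
      case True
      then show ?thesis using p0 by (auto simp: A_def)
    next
      case False
      from C(1) have "\<And>q. q \<in> C \<Longrightarrow> sublinear q" "\<And>q. q \<in> C \<Longrightarrow> q \<le> p0"
        by (auto simp: A_def)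
      from sublinear_Inf[OF False this C(2)] obtain u where u: "sublinear u" "\<forall>q\<in>C. u \<le> q" by blast
      obtain q where "q \<in> C" using False by blast
      with u C(1) have "u \<le> p0" unfolding A_def using order_trans by blast
      with u show ?thesis by (auto simp: A_def)
    qed
  qed
  then obtain f where f: "sublinear f" "f \<le> p0" "\<And>q. sublinear q \<Longrightarrow> q \<le> f \<Longrightarrow> q = f"
    unfolding A_def using order_trans by blast
  have lin: "linear f" by (rule sublinear_minimal_linear[OF f(1,3)])
  have "f \<le> p" using f(2) p0(2) by (rule order_trans)
  moreover have "f z \<ge> p z"
    using f(2) p0(3) linear_neg[OF lin, of z] by (auto simp: le_fun_def dest: spec[of _ "- z"])
  ultimately show ?thesis using lin by (auto simp: le_fun_def intro!: antisym)
qed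

section \<open>Tensors of continuous functionals\<close>

text \<open>
  The topological dual of a normed space separates points.  The functional \<open>f\<close> is obtained on the
  whole type, with the norm pulled back along a linear projection onto \<open>S\<close> as dominating seminorm;
  on \<open>S\<close> it is bounded by the norm.
\<close>

lemma topological_dual_extend:
  fixes S :: "'a::real_vector set"
  assumes S: "subspace S" and n: "norm_on S n" and x: "x \<in> S" "x \<noteq> 0"
  shows "\<exists>f. linear f \<and> f x \<noteq> 0 \<and> (\<lambda>y. if y \<in> S then f y else 0) \<in> topological_dual S n"
proof -
  obtain \<pi> :: "'a \<Rightarrow> 'a" where \<pi>: "range \<pi> \<subseteq> S" "linear \<pi>" "\<And>y. y \<in> S \<Longrightarrow> \<pi> y = y"
    using linear_exists_left_inverse_on[OF linear_id S] by auto
  have mem: "\<pi> y \<in> S" for y using \<pi>(1) by auto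
  have "sublinear (\<lambda>y. n (\<pi> y))"
    using n mem unfolding sublinear_def norm_on_def
    by (simp add: linear_add[OF \<pi>(2)] linear_cmul[OF \<pi>(2)])
  from Hahn_Banach_sublinear[OF this, of x] obtain f
    where f: "linear f" "f \<le> (\<lambda>y. n (\<pi> y))" "f x = n (\<pi> x)" by blast
  have f_le: "f y \<le> n y" if "y \<in> S" for y
    using f(2) \<pi>(3)[OF that] by (auto simp: le_fun_def dest: spec[of _ y])
  have "f x \<noteq> 0" using n x f(3) by (simp add: \<pi>(3) norm_on_def)
  define g where "g y = (if y \<in> S then f y else 0)" for y
  let ?d = "\<lambda>x y. if x \<in> S \<and> y \<in> S then n (x - y) else 0"
  interpret M: Metric_space S ?d by (rule Metric_space_norm_on[OF S n])
  \<comment> \<open>\<open>f \<le> n\<close> on \<open>S\<close> makes \<open>g\<close> Lipschitz with constant \<open>1\<close>.\<close>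
  have "continuous_map M.mtopology euclideanreal g"
    unfolding mtopology_is_euclidean[symmetric] M.metric_continuous_map[OF Met_TC.Metric_space_axioms]
  proof (intro conjI ballI allI impI)
    fix a and \<epsilon> :: real assume a: "a \<in> S" and \<epsilon>: "\<epsilon> > 0"
    have "dist (g a) (g y) < \<epsilon>" if "y \<in> S \<and> ?d a y < \<epsilon>" for y
    proof -
      have "a - y \<in> S" "y - a \<in> S" using S a that by (auto intro: subspace_diff)
      then have "f a - f y \<le> n (a - y)" "f y - f a \<le> n (y - a)"
        using f_le linear_diff[OF f(1)] by metis+
      moreover have "n (y - a) = n (a - y)" using M.commute[of y a] a that by simp
      ultimately show ?thesis using a that by (auto simp: g_def dist_real_def abs_less_iff)
    qed
    with \<epsilon> show "\<exists>\<delta>>0. \<forall>y. y \<in> S \<and> ?d a y < \<delta> \<longrightarrow> dist (g a) (g y) < \<epsilon>" by blast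
  qed auto
  then have "g \<in> topological_dual S n"
    unfolding topological_dual_def norm_topology_def using S
    by (auto simp: g_def subspace_add subspace_scale linear_add[OF f(1)] linear_cmul[OF f(1)])
  with f(1) \<open>f x \<noteq> 0\<close> show ?thesis unfolding g_def by blast
qed

text \<open>
  Elements of the product of the duals thus act as restrictions of linear functionals on
  the whole type, which is the form in which they enter \<open>contract\<close> and \<open>slice\<close>.
\<close>

lemma tensor_functional_linear:
  assumes J: "finite J" and W: "\<And>j. j \<in> J \<Longrightarrow> subspace (W j)"
    and \<phi>: "\<phi> \<in> tensor_product J (\<lambda>j. topological_dual (W j) (N j))"
  shows "\<exists>g. linear g \<and> (\<forall>t\<in>tensor_product J W. tensor_functional J W N \<phi> t = g t)"
proof -
  let ?D = "\<lambda>j. topological_dual (W j) (N j)"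
  let ?T = "tensor_functional J W N"
  let ?M = "\<lambda>\<phi>. tensor_lift J W (\<lambda>w. \<Prod>j\<in>J. \<phi> j (w j))"
  have add: "?T (s + t) = ?T s + ?T t"
    if "s \<in> tensor_product J ?D" "t \<in> tensor_product J ?D" for s t
    unfolding tensor_functional_def
    by (rule tensor_lift_add[OF subspace_topological_dual multilinear_on_tensor_functional[OF J W] that])
  have scale: "?T (c *\<^sub>R s) = c *\<^sub>R ?T s" if "s \<in> tensor_product J ?D" for c s
    unfolding tensor_functional_def
    by (rule tensor_lift_scaleR[OF subspace_topological_dual multilinear_on_tensor_functional[OF J W] that])
  have elem: "?T (elem_tensor J \<xi>) = ?M \<xi>" if "\<And>j. j \<in> J \<Longrightarrow> \<xi> j \<in> ?D j" for \<xi>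
    unfolding tensor_functional_def
    by (rule tensor_lift_elem[OF subspace_topological_dual multilinear_on_tensor_functional[OF J W] that])
  have "\<phi> \<in> tensor_product J ?D \<and> (\<exists>g. linear g \<and> (\<forall>t\<in>tensor_product J W. ?T \<phi> t = g t))"
    using \<phi> unfolding tensor_product_def[of J ?D]
  proof (induction rule: span_induct_alt)
    case base
    have "0 \<in> tensor_product J ?D" by (rule subspace_0[OF subspace_tensor_product])
    from scale[OF this, of 0] have "?T 0 = 0" by simp
    then show ?case by (auto intro!: exI[of _ "\<lambda>_. 0"] linear_zero span_zero)
  next
    case (step c x y)
    then obtain \<xi> where x: "x = elem_tensor J \<xi>" and \<xi>: "\<And>j. j \<in> J \<Longrightarrow> \<xi> j \<in> ?D j" by blast
    have xin: "x \<in> tensor_product J ?D" unfolding x by (rule elem_tensor_in[OF \<xi>])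
    have yin: "y \<in> tensor_product J ?D" using step by (simp add: tensor_product_def)
    have cxin: "c *\<^sub>R x \<in> tensor_product J ?D" by (rule subspace_scale[OF subspace_tensor_product xin])
    have "multilinear_on J W (\<lambda>w. \<Prod>j\<in>J. \<xi> j (w j))"
      by (rule multilinear_on_prod_functionals[where N = N, OF J \<xi>])
    then have "\<exists>L. linear L \<and> (\<forall>w. (\<forall>j\<in>J. w j \<in> W j) \<longrightarrow> L (elem_tensor J w) = (\<Prod>j\<in>J. \<xi> j (w j)))"
      by (rule tensor_product_universal[rotated]) (rule W)
    then obtain L where L: "linear L" "\<And>w. (\<And>j. j \<in> J \<Longrightarrow> w j \<in> W j) \<Longrightarrow> L (elem_tensor J w) = (\<Prod>j\<in>J. \<xi> j (w j))"
      by blast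
    obtain g where g: "linear g" "\<And>t. t \<in> tensor_product J W \<Longrightarrow> ?T y t = g t"
      using step by blast
    have "?T (c *\<^sub>R x + y) t = c * L t + g t" if t: "t \<in> tensor_product J W" for t
    proof -
      have "?T (c *\<^sub>R x + y) = c *\<^sub>R ?T x + ?T y"
        by (simp only: add[OF cxin yin] scale[OF xin])
      moreover have "?T x = ?M \<xi>" unfolding x by (rule elem) (rule \<xi>)
      moreover have "?M \<xi> t = L t"
        by (rule tensor_lift_eqI[OF L(1) _ t]) (rule L(2))
      ultimately show ?thesis by (simp add: scaleR_fun_apply g(2)[OF t])
    qed
    moreover have "linear (\<lambda>t. c * L t + g t)"
      using linear_compose_add[OF linear_compose_scale_right[OF L(1), of c] g(1)] by simp
    ultimately have "\<exists>g. linear g \<and> (\<forall>t\<in>tensor_product J W. ?T (c *\<^sub>R x + y) t = g t)" by blast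
    moreover have "c *\<^sub>R x + y \<in> tensor_product J ?D"
      by (rule subspace_add[OF subspace_tensor_product cxin yin])
    ultimately show ?case by (simp add: tensor_product_def)
  qed
  then show ?thesis by blast
qed

text \<open>
  The maps \<open>id\<^sub>\<beta> \<otimes> \<phi>\<close> of the proposition, which act on tensors regrouped along \<open>P\<close>, are slices of
  ungrouped tensors.
\<close>

lemma id_tensor_regroup_eq_slice:
  fixes V :: "'i \<Rightarrow> 'a::real_vector set"
  assumes P: "disjoint P" "\<beta> \<in> P" and g: "linear g"
    and f: "\<And>t. t \<in> tensor_product (P - {\<beta>}) (\<lambda>\<gamma>. tensor_product \<gamma> V) \<Longrightarrow> f t = g t"
    and u: "u \<in> tensor_product (\<Union>P) V"
  shows "id_tensor P (\<lambda>\<gamma>. tensor_product \<gamma> V) \<beta> f (regroup P u) =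
    slice (\<Union>P) \<beta> (g \<circ> linear_regroup (P - {\<beta>})) u"
proof -
  let ?W = "\<lambda>\<gamma>. tensor_product \<gamma> V" and ?J = "P - {\<beta>}"
  have J: "disjoint ?J" "\<Union>P - \<beta> = \<Union>?J" "\<beta> \<subseteq> \<Union>P"
    using P by (auto simp: disjoint_def)
  have lin: "linear (g \<circ> linear_regroup ?J)"
    by (intro linear_compose linear_linear_regroup J g)
  have "id_tensor P ?W \<beta> f (regroup P u) = contract P \<beta> g (linear_regroup P u)"
    unfolding regroup_eq_linear_regroup[OF P(1) u] id_tensor_def
  proof (rule tensor_lift_eqI[OF linear_contract[OF P(2) g] _ linear_regroup_in[OF P(1) u]])
    fix w assume "\<And>\<gamma>. \<gamma> \<in> P \<Longrightarrow> w \<gamma> \<in> ?W \<gamma>"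
    then have "elem_tensor ?J w \<in> tensor_product ?J ?W" by (intro elem_tensor_in) auto
    then show "contract P \<beta> g (elem_tensor P w) = f (elem_tensor ?J w) *\<^sub>R w \<beta>"
      by (simp add: contract_elem[OF P(2) g] f)
  qed
  also have "\<dots> = (contract P \<beta> g \<circ> linear_regroup P) u" by simp
  also have "\<dots> = slice (\<Union>P) \<beta> (g \<circ> linear_regroup ?J) u"
    by (rule linear_eq_on_tensor_product[OF _ _ u],
        (intro linear_slice[OF J(3) lin] linear_compose linear_contract linear_linear_regroup P g)+)
       (simp only: comp_def linear_regroup_elem[OF P(1)] contract_elem[OF P(2) g]
         slice_elem[OF J(3) lin, unfolded comp_def] J(2) linear_regroup_elem[OF J(1)])
  finally show ?thesis .
qed

text \<open>
  The elementary tensors \<open>\<Otimes>\<^sub>\<gamma> \<phi>\<^sub>\<gamma>\<close> of continuous functionals already separate: they are the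
  block functionals built from the families \<open>F \<gamma>\<close> of linear functionals that are continuous on the
  block \<open>\<gamma>\<close>, and each \<open>F \<gamma>\<close> separates by the Hahn-Banach theorem.
\<close>

lemma dual_tensors_separate:
  fixes V :: "'i \<Rightarrow> 'a::real_vector set" and N :: "'i set \<Rightarrow> ('i, 'a) tensor \<Rightarrow> real"
  defines "W \<equiv> \<lambda>\<gamma>. tensor_product \<gamma> V"
  assumes J: "finite J" "disjoint J" "\<And>\<gamma>. \<gamma> \<in> J \<Longrightarrow> finite \<gamma>"
    and N: "\<And>\<gamma>. \<gamma> \<in> J \<Longrightarrow> norm_on (W \<gamma>) (N \<gamma>)"
  shows "separates {g \<circ> linear_regroup J | g \<phi>. linear g \<and>
      \<phi> \<in> tensor_product J (\<lambda>\<gamma>. topological_dual (W \<gamma>) (N \<gamma>)) \<and>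
      (\<forall>t\<in>tensor_product J W. tensor_functional J W N \<phi> t = g t)}
    (tensor_product (\<Union>J) V)" (is "separates ?G _")
proof (rule separatesI)
  \<comment> \<open>Elements of the dual vanish outside \<open>W \<gamma>\<close>, linear functionals on the type need not.\<close>
  let ?cut = "\<lambda>\<gamma> h t. if t \<in> W \<gamma> then h t else 0 :: real"
  define F where "F \<gamma> = {h. linear h \<and> ?cut \<gamma> h \<in> topological_dual (W \<gamma>) (N \<gamma>)}" for \<gamma>
  have W: "subspace (W \<gamma>)" for \<gamma> by (simp add: W_def subspace_tensor_product)
  have F: "separates (F \<gamma>) (tensor_product \<gamma> V)" if "\<gamma> \<in> J" for \<gamma>
  proof (rule separatesI, rule ccontr)
    fix t assume t: "t \<in> tensor_product \<gamma> V" "\<And>h. h \<in> F \<gamma> \<Longrightarrow> h t = 0" "t \<noteq> 0"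
    then show False
      using topological_dual_extend[OF W N[OF that], of t] by (auto simp: F_def W_def)
  qed
  have linF: "linear h" if "h \<in> F \<gamma>" for h \<gamma> using that by (simp add: F_def)
  fix t assume t: "t \<in> tensor_product (\<Union>J) V" and 0: "\<And>\<Psi>. \<Psi> \<in> ?G \<Longrightarrow> \<Psi> t = 0"
  show "t = 0"
  proof (rule separatesD[OF block_functionals_separate[OF J F linF] t])
    fix b assume "b \<in> {block_functional J h | h. \<forall>\<gamma>\<in>J. h \<gamma> \<in> F \<gamma>}"
    then obtain h where b: "b = block_functional J h" and h: "\<And>\<gamma>. \<gamma> \<in> J \<Longrightarrow> h \<gamma> \<in> F \<gamma>" by blast
    have linh: "linear (h \<gamma>)" if "\<gamma> \<in> J" for \<gamma> using linF[OF h[OF that]] .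
    let ?\<phi> = "elem_tensor J (\<lambda>\<gamma>. ?cut \<gamma> (h \<gamma>))"
    have cut: "?cut \<gamma> (h \<gamma>) \<in> topological_dual (W \<gamma>) (N \<gamma>)" if "\<gamma> \<in> J" for \<gamma>
      using h[OF that] by (simp add: F_def)
    have \<phi>: "?\<phi> \<in> tensor_product J (\<lambda>\<gamma>. topological_dual (W \<gamma>) (N \<gamma>))"
      by (rule elem_tensor_in[OF cut])
    from tensor_functional_linear[OF J(1) W \<phi>] obtain g
      where g: "linear g" "\<forall>t\<in>tensor_product J W. tensor_functional J W N ?\<phi> t = g t" by blast
    have "g \<circ> linear_regroup J \<in> ?G" using g \<phi> by blast
    then have "(g \<circ> linear_regroup J) t = 0" by (rule 0)
    moreover have "b t = (g \<circ> linear_regroup J) t"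
    proof (rule linear_eq_on_tensor_product[OF _ _ t])
      show "linear b" unfolding b by (rule linear_block_functional[OF J(1,2) linh])
      show "linear (g \<circ> linear_regroup J)"
        by (intro linear_compose linear_linear_regroup J g)
      fix x assume x: "\<And>i. i \<in> \<Union>J \<Longrightarrow> x i \<in> V i"
      have xW: "elem_tensor \<gamma> x \<in> W \<gamma>" if "\<gamma> \<in> J" for \<gamma>
        unfolding W_def using x that by (intro elem_tensor_in) auto
      have "g (elem_tensor J (\<lambda>\<gamma>. elem_tensor \<gamma> x)) =
          tensor_functional J W N ?\<phi> (elem_tensor J (\<lambda>\<gamma>. elem_tensor \<gamma> x))"
        by (rule g(2)[rule_format, symmetric]) (rule elem_tensor_in[OF xW])
      also have "\<dots> = (\<Prod>\<gamma>\<in>J. ?cut \<gamma> (h \<gamma>) (elem_tensor \<gamma> x))"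
        by (rule tensor_functional_elem[OF J(1) W cut xW])
      also have "\<dots> = (\<Prod>\<gamma>\<in>J. h \<gamma> (elem_tensor \<gamma> x))"
        by (rule prod.cong) (simp_all add: xW)
      also have "\<dots> = b (elem_tensor (\<Union>J) x)"
        unfolding b by (rule block_functional_elem[OF J(1,2) linh, symmetric])
      finally show "b (elem_tensor (\<Union>J) x) = (g \<circ> linear_regroup J) (elem_tensor (\<Union>J) x)"
        by (simp add: linear_regroup_elem[OF J(2)])
    qed
    ultimately show "b t = 0" by simp
  qed
qed

section \<open>The minimal subspace of a block\<close>

theorem proposition3:
  fixes d :: nat
    and V :: "nat \<Rightarrow> 'a::real_vector set"
    and v :: "(nat, 'a) tensor"
    and \<alpha> \<beta> :: "nat set"
    and P :: "nat set set"
    and N :: "nat set \<Rightarrow> (nat, 'a) tensor \<Rightarrow> real"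
  assumes "\<And>j. j \<in> {1..d} \<Longrightarrow> subspace (V j)"
    and "v \<in> tensor_product {1..d} V"
    and "\<alpha> \<subseteq> {1..d}" and "card \<alpha> \<ge> 2"
    and "partition_on \<alpha> P" and "card P \<ge> 2"
    and "norm_on (tensor_product \<alpha> V) (N \<alpha>)"
    and "\<And>\<gamma>. \<gamma> \<in> P \<Longrightarrow> norm_on (tensor_product \<gamma> V) (N \<gamma>)"
    and "\<beta> \<in> P"
  shows "min_subspace {1..d} V v \<beta> =
    span {id_tensor P (\<lambda>\<gamma>. tensor_product \<gamma> V) \<beta>
            (tensor_functional (P - {\<beta>}) (\<lambda>\<gamma>. tensor_product \<gamma> V) N \<phi>) (regroup P u) | u \<phi>.
          u \<in> min_subspace {1..d} V v \<alpha> \<and>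
          \<phi> \<in> tensor_product (P - {\<beta>}) (\<lambda>\<gamma>. topological_dual (tensor_product \<gamma> V) (N \<gamma>))}"
proof -
  let ?J = "P - {\<beta>}" and ?W = "\<lambda>\<gamma>. tensor_product \<gamma> V"
  let ?D = "\<lambda>\<gamma>. topological_dual (?W \<gamma>) (N \<gamma>)"
  let ?ind = "\<lambda>g \<phi>. linear g \<and> \<phi> \<in> tensor_product ?J ?D \<and>
      (\<forall>t\<in>tensor_product ?J ?W. tensor_functional ?J ?W N \<phi> t = g t)"
  let ?G = "{g \<circ> linear_regroup ?J | g \<phi>. ?ind g \<phi>}"
  have fin\<alpha>: "finite \<alpha>" by (rule finite_subset[OF assms(3)]) simp
  have P: "disjoint P" "\<Union>P = \<alpha>" "finite P"
    using assms(5) finite_elements[OF fin\<alpha> assms(5)] by (auto simp: partition_on_def)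
  have J: "disjoint ?J" "\<alpha> - \<beta> = \<Union>?J" "\<beta> \<subseteq> \<alpha>" "finite ?J" "\<And>\<gamma>. \<gamma> \<in> ?J \<Longrightarrow> finite \<gamma>"
    using P assms(9) fin\<alpha> by (auto simp: disjoint_def intro: finite_subset)
  have G: "separates ?G (tensor_product (\<alpha> - \<beta>) V)"
    unfolding J(2) by (rule dual_tensors_separate[OF J(4,1,5)]) (use assms(8) in auto)
  have linG: "linear \<Psi>" if "\<Psi> \<in> ?G" for \<Psi>
    using that by (auto intro!: linear_compose linear_linear_regroup J)
  \<comment> \<open>The maps \<open>id\<^sub>\<beta> \<otimes> \<phi>\<close> are exactly the slices by the separating family \<open>?G\<close>.\<close>
  have key: "id_tensor P ?W \<beta> (tensor_functional ?J ?W N \<phi>) (regroup P u) =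
      slice \<alpha> \<beta> (g \<circ> linear_regroup ?J) u"
    if "u \<in> min_subspace {1..d} V v \<alpha>" "?ind g \<phi>" for u \<phi> g
    unfolding P(2)[symmetric]
    by (rule id_tensor_regroup_eq_slice[OF P(1) assms(9)])
       (use that min_subspace_subset[OF _ assms(3,2)] P(2) in auto)
  have ind: "\<exists>g. ?ind g \<phi>" if "\<phi> \<in> tensor_product ?J ?D" for \<phi>
    using tensor_functional_linear[OF J(4) subspace_tensor_product that] that by blast
  have "min_subspace {1..d} V v \<beta> =
      span {slice \<alpha> \<beta> \<Psi> u | u \<Psi>. u \<in> min_subspace {1..d} V v \<alpha> \<and> \<Psi> \<in> ?G}"
    by (rule min_subspace_nested[OF _ J(3) assms(3,2) G linG]) auto
  also have "{slice \<alpha> \<beta> \<Psi> u | u \<Psi>. u \<in> min_subspace {1..d} V v \<alpha> \<and> \<Psi> \<in> ?G} =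
      {id_tensor P ?W \<beta> (tensor_functional ?J ?W N \<phi>) (regroup P u) | u \<phi>.
        u \<in> min_subspace {1..d} V v \<alpha> \<and> \<phi> \<in> tensor_product ?J ?D}" (is "?L = ?R")
  proof (rule antisym)
    show "?L \<subseteq> ?R"
    proof
      fix s assume "s \<in> ?L"
      then obtain u g \<phi> where u: "u \<in> min_subspace {1..d} V v \<alpha>" and g: "?ind g \<phi>"
        and s: "s = slice \<alpha> \<beta> (g \<circ> linear_regroup ?J) u" by blast
      show "s \<in> ?R" unfolding s key[OF u g, symmetric] using u g by blast
    qed
    show "?R \<subseteq> ?L"
    proof
      fix s assume "s \<in> ?R"
      then obtain u \<phi> where u: "u \<in> min_subspace {1..d} V v \<alpha>" "\<phi> \<in> tensor_product ?J ?D"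
        and s: "s = id_tensor P ?W \<beta> (tensor_functional ?J ?W N \<phi>) (regroup P u)" by blast
      from ind[OF u(2)] obtain g where g: "?ind g \<phi>" by blast
      show "s \<in> ?L" unfolding s key[OF u(1) g] using u g by blast
    qed
  qed
  finally show ?thesis .
qed

end
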